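(* Let $y\in\mathbb{R}^n$ and $X=[X_1,\dots,X_p]\in\mathbb{R}^{n\times p}$ with columns $X_j\in\mathbb{R}^n$. For $\lambda\in\mathbb{R}$ consider the Lasso problem $$\hat\beta(\lambda)\in\operatorname{argmin}\left\{\tfrac12\|y-X\beta\|_2^2+e^\lambda\|\beta\|_1\;:\;\beta\in\mathbb{R}^p\right\},$$ and let $\mathcal{E}=\mathcal{E}(\lambda)$ be the equicorrelation set defined in the context. For all $\lambda\in\mathbb{R}$, assume that $X_{\mathcal{E}}^TX_{\mathcal{E}}$ is invertible, where $X_{\mathcal{E}}$ is the submatrix of $X$ formed by taking the columns indexed by $\mathcal{E}$. Then $\hat\beta(\lambda)$ is single-valued and $\lambda\mapsto\hat\beta(\lambda)$ is path differentiable, with conservative Jacobian $J_{\hat\beta}(\lambda)$ given for all $\lambda\in\mathbb{R}$ by $$\left\{-e^\lambda\big(\mathrm{Id}_p-\mathrm{diag}(q)(\mathrm{Id}_p-X^TX)\big)^{-1}\mathrm{diag}(q)\,\mathrm{sign}\big(\hat\beta-X^T(X\hat\beta-y)\big)\;:\;q\in\mathcal{M}(\lambda)\right\},$$ where $\hat\beta=\hat\beta(\lambda)$ and $\mathcal{M}(\lambda)\subset\mathbb{R}^p$ is the set of vectors $q$ such that $q_i=1$ if $i\in\operatorname{supp}\hat\beta$, $q_i=0$ if $i\notin\mathcal{E}$, and $q_i\in[0,1]$ if $i\in\mathcal{E}\setminus\operatorname{supp}\hat\beta$.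
   Context: For a solution $\hat\beta(\lambda)$ of the Lasso problem, the equicorrelation set is $\mathcal{E}=\{j\in\{1,\dots,p\}:\ |X_j^T(y-X\hat\beta(\lambda))|=e^\lambda\}$; it does not depend on the choice of solution and contains the support $\operatorname{supp}\hat\beta=\{i:\hat\beta_i\ne0\}$. $\mathrm{diag}(q)$ is the diagonal matrix with diagonal $q$; $\mathrm{sign}$ acts componentwise with values in $\{-1,0,1\}$. Conservative Jacobian: for a locally Lipschitz $H:\mathbb{R}^a\to\mathbb{R}^b$, a set-valued map $J_H:\mathbb{R}^a\rightrightarrows\mathbb{R}^{b\times a}$ is a conservative Jacobian for $H$ if it has nonempty values, has a closed graph, is locally bounded, and for every absolutely continuous curve $\gamma:[0,1]\to\mathbb{R}^a$ one has, for almost every $t$, $\frac{d}{dt}H(\gamma(t))=M\dot\gamma(t)$ for all $M\in J_H(\gamma(t))$. A locally Lipschitz function is path differentiable if it has a conservative Jacobian. *)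

theory Defs
  imports "HOL-Analysis.Analysis"
begin

definition locally_lipschitz :: "('a::metric_space \<Rightarrow> 'b::metric_space) \<Rightarrow> bool" where
  "locally_lipschitz H \<longleftrightarrow> (\<forall>x. \<exists>e>0. \<exists>L. L-lipschitz_on (ball x e) H)"

text \<open>
  The epsilon-delta notion for functions (the library's \<open>absolutely_continuous\<close> is about
  measures). A finite family of non-overlapping compact intervals inside \<open>S\<close> is rendered as
  a division \<open>d\<close> of its own union \<open>T \<subseteq> S\<close>.
\<close>

definition absolutely_continuous_fun_on ::
    "real set \<Rightarrow> (real \<Rightarrow> 'a::real_normed_vector) \<Rightarrow> bool" where
  "absolutely_continuous_fun_on S g \<longleftrightarrow>
     (\<forall>e>0. \<exists>d>0. \<forall>D T. D division_of T \<and> T \<subseteq> S \<and> (\<Sum>K\<in>D. measure lborel K) < d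
        \<longrightarrow> (\<Sum>K\<in>D. norm (g (Sup K) - g (Inf K))) < e)"

text \<open>
  Existence of both derivatives almost everywhere is part of the curve condition. A curve is a
  function on all of \<open>real\<close> of which only the restriction to \<open>[0,1]\<close> matters.
\<close>

definition conservative_jacobian ::
    "(real^'a \<Rightarrow> real^'b) \<Rightarrow> (real^'a \<Rightarrow> (real^'a^'b) set) \<Rightarrow> bool" where
  "conservative_jacobian H J \<longleftrightarrow>
     (\<forall>x. J x \<noteq> {}) \<and>
     closed {(x, M). M \<in> J x} \<and>
     (\<forall>x. \<exists>e>0. bounded (\<Union>z\<in>ball x e. J z)) \<and>
     (\<forall>g. absolutely_continuous_fun_on {0..1} g \<longrightarrow>
        (AE t in lebesgue_on {0..1}.
           \<exists>v. (g has_vector_derivative v) (at t within {0..1}) \<and>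
               (\<forall>M\<in>J (g t).
                  ((\<lambda>s. H (g s)) has_vector_derivative (M *v v)) (at t within {0..1}))))"

definition path_differentiable :: "(real^'a \<Rightarrow> real^'b) \<Rightarrow> bool" where
  "path_differentiable H \<longleftrightarrow> locally_lipschitz H \<and> (\<exists>J. conservative_jacobian H J)"

definition diag_mat :: "real^'n \<Rightarrow> real^'n^'n" where
  "diag_mat q = (\<chi> i j. if i = j then q $ i else 0)"

text \<open>Componentwise, unlike \<open>sgn\<close> at type \<open>real^'n\<close>, which normalizes the vector.\<close>

definition sign_vec :: "real^'n \<Rightarrow> real^'n" where
  "sign_vec v = (\<chi> i. sgn (v $ i))"

definition supp_vec :: "real^'n \<Rightarrow> 'n set" where
  "supp_vec v = {i. v $ i \<noteq> 0}"

text \<open>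
  Invertibility of the submatrix of \<open>A\<close> with rows and columns indexed by \<open>E\<close>: only the entries
  of \<open>A\<close> and \<open>B\<close> in \<open>E \<times> E\<close> are used. For empty \<open>E\<close> this is the (invertible)
  \<open>0 \<times> 0\<close> matrix.
  For \<open>A = X\<^sup>T X\<close> this submatrix is the Gram matrix of the columns of \<open>X\<close> indexed by \<open>E\<close>.
\<close>

definition invertible_principal_submatrix :: "real^'n^'n \<Rightarrow> 'n set \<Rightarrow> bool" where
  "invertible_principal_submatrix A E \<longleftrightarrow>
     (\<exists>B::real^'n^'n. \<forall>i\<in>E. \<forall>j\<in>E.
        (\<Sum>k\<in>E. A $ i $ k * B $ k $ j) = (if i = j then 1 else 0) \<and>
        (\<Sum>k\<in>E. B $ i $ k * A $ k $ j) = (if i = j then 1 else 0))"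

definition lasso_objective :: "real^'p^'n \<Rightarrow> real^'n \<Rightarrow> real \<Rightarrow> real^'p \<Rightarrow> real" where
  "lasso_objective X y l b =
     1/2 * (norm (y - X *v b))\<^sup>2 + exp l * (\<Sum>i\<in>UNIV. \<bar>b $ i\<bar>)"

definition lasso_argmin :: "real^'p^'n \<Rightarrow> real^'n \<Rightarrow> real \<Rightarrow> (real^'p) set" where
  "lasso_argmin X y l = {b. is_arg_min (lasso_objective X y l) (\<lambda>_. True) b}"

definition equicorrelation_set ::
    "real^'p^'n \<Rightarrow> real^'n \<Rightarrow> real \<Rightarrow> real^'p \<Rightarrow> 'p set" where
  "equicorrelation_set X y l b = {j. \<bar>column j X \<bullet> (y - X *v b)\<bar> = exp l}"

definition lasso_multipliers ::
    "real^'p^'n \<Rightarrow> real^'n \<Rightarrow> real \<Rightarrow> real^'p \<Rightarrow> (real^'p) set" where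
  "lasso_multipliers X y l b =
     {q. (\<forall>i\<in>supp_vec b. q $ i = 1) \<and>
         (\<forall>i. i \<notin> equicorrelation_set X y l b \<longrightarrow> q $ i = 0) \<and>
         (\<forall>i\<in>equicorrelation_set X y l b - supp_vec b. 0 \<le> q $ i \<and> q $ i \<le> 1)}"

definition lasso_system_matrix :: "real^'p^'n \<Rightarrow> real^'p \<Rightarrow> real^'p^'p" where
  "lasso_system_matrix X q = mat 1 - diag_mat q ** (mat 1 - transpose X ** X)"

text \<open>\<open>b\<close> stands for the solution at \<open>l\<close>; the vectors are returned as \<open>p \<times> 1\<close> matrices.\<close>

definition lasso_jacobian ::
    "real^'p^'n \<Rightarrow> real^'n \<Rightarrow> real \<Rightarrow> real^'p \<Rightarrow> (real^1^'p) set" where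
  "lasso_jacobian X y l b =
     {columnvector (- exp l *\<^sub>R
        (matrix_inv (lasso_system_matrix X q) *v
          (diag_mat q *v sign_vec (b - transpose X *v (X *v b - y))))) | q.
      q \<in> lasso_multipliers X y l b}"

end

theory Submission
  imports Defs
begin

text \<open>
  The KKT conditions say that the correlation \<open>X\<^sup>T(y - X b)\<close> is a subgradient of \<open>e\<^sup>\<lambda>\<close> times
  the 1-norm at \<open>b\<close>. Monotonicity of the subdifferential bounds \<open>|X(b - b')|\<^sup>2\<close> by
  \<open>(\<mu>' - \<mu>)(|b|\<^sub>1 - |b'|\<^sub>1)\<close> for solutions at \<open>\<mu>\<close> and \<open>\<mu>'\<close>. Hence \<open>X b\<close> is continuous in the
  parameter, the equicorrelation set can only shrink nearby, and injectivity of \<open>X\<close> on vectors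
  supported there gives uniqueness and local Lipschitz continuity. Solutions with the same sign
  pattern form a convex family, so up to finitely many breakpoints the path is locally affine in
  \<open>e\<^sup>\<lambda>\<close>, and there its derivative solves the linear system for every admissible \<open>q\<close>.

  Along an absolutely continuous curve, which is differentiable almost everywhere by a Vitali
  covering argument, the chain rule is then clear off the breakpoints and where the curve has
  zero speed; a breakpoint is met with nonzero speed only at isolated, hence countably many, times.
\<close>

section \<open>Differentiability of absolutely continuous functions\<close>

text \<open>On the equicorrelation set, with \<open>s\<close> the sign of the correlation, row
  \<open>i\<close> of the linear system reads \<open>(1 - q $ i) * w $ i + q $ i * ((transpose X *v
  (X *v w)) $ i - s) = 0\<close>. It weighs two statements about a motion along \<open>w\<close>:
  coefficient \<open>i\<close> stays fixed, and the bound on correlation \<open>i\<close> stays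
  active. Off the breakpoints both hold wherever \<open>q $ i\<close> is free, so all multipliers
  give the same derivative there. The factor \<open>- exp l\<close> comes from the substitution
  \<open>\<mu> = exp l\<close>, with \<open>w\<close> minus the slope of the path in
  \<open>\<mu>\<close>. At a breakpoint the solutions for different \<open>q\<close> may disagree,
  so visits there with nonzero speed must form a null set of times. Continuity of the fit has to
  precede continuity of the path: \<open>X\<close> is injective only on vectors supported in one
  equicorrelation set, so two solutions can be compared only once their sets are known to lie in a
  common one.\<close>

lemma division_sum_telescope:
  fixes f :: "real \<Rightarrow> 'a::real_normed_vector"
  assumes "D division_of {a..b}" "a \<le> b"
  shows "(\<Sum>K\<in>D. f (Sup K) - f (Inf K)) = f b - f a"
proof -
  \<comment> \<open>Left endpoints serve as tags, so that the telescoping sum for tagged divisions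
    applies.\<close>
  let ?p = "(\<lambda>K. (Inf K, K)) ` D"
  have K: "\<exists>u v. K = {u..v} \<and> u \<le> v" if "K \<in> D" for K
    using division_ofD(3,4)[OF assms(1) that] by (metis atLeastatMost_empty box_real(2) not_le)
  have "?p tagged_division_of {a..b}"
  proof (rule tagged_division_ofI)
    show "finite ?p" using assms by auto
    show "\<Union>{K. \<exists>x. (x, K) \<in> ?p} = {a..b}"
    proof -
      have "{K. \<exists>x. (x, K) \<in> ?p} = D" by auto
      then show ?thesis using division_ofD(6)[OF assms(1)] by simp
    qed
    show "x \<in> K" if "(x, K) \<in> ?p" for x K
      using that K by fastforce
    show "K \<subseteq> {a..b}" if "(x, K) \<in> ?p" for x K
      using that division_ofD(2)[OF assms(1)] by auto
    show "\<exists>u v. K = cbox u v" if "(x, K) \<in> ?p" for x K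
      using that division_ofD(4)[OF assms(1)] by auto
    show "interior K1 \<inter> interior K2 = {}"
      if "(x1, K1) \<in> ?p" "(x2, K2) \<in> ?p" "(x1, K1) \<noteq> (x2, K2)" for x1 K1 x2 K2
      using that division_ofD(5)[OF assms(1), of K1 K2] by auto
  qed
  from additive_tagged_division_1[OF assms(2) this, of f]
  show ?thesis
    by (subst (asm) sum.reindex) (auto simp: inj_on_def)
qed

lemma division_real_cases:
  assumes "D division_of S" "K \<in> D"
  obtains u v :: real where "K = {u..v}" "u \<le> v" "{u..v} \<subseteq> S"
  using division_ofD(2,3,4)[OF assms] by (metis atLeastatMost_empty box_real(2) not_le)

text \<open>Vitali's theorem extracts disjoint steep intervals that cover \<open>E\<close> up to a
  null set. The increments of a monotone function over disjoint intervals add up to at most its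
  total increment, and each is at least \<open>\<alpha>\<close> times the length.\<close>

lemma monotone_steep_cover:
  fixes m :: "real \<Rightarrow> real"
  assumes mono: "\<And>u v. a \<le> u \<Longrightarrow> u \<le> v \<Longrightarrow> v \<le> b \<Longrightarrow> m u \<le> m v"
    and "a \<le> b" "\<alpha> > 0"
    and E: "\<And>x d. x \<in> E \<Longrightarrow> 0 < d \<Longrightarrow>
      \<exists>u v. a \<le> u \<and> u < v \<and> v \<le> b \<and> x \<in> {u..v} \<and> v - u < d \<and> \<alpha> * (v - u) \<le> m v - m u"
  shows "\<exists>W \<in> lmeasurable. E \<subseteq> W \<and> \<alpha> * measure lebesgue W \<le> m b - m a"
proof -
  define I where "I = {(u, v). a \<le> u \<and> u < v \<and> v \<le> b \<and> \<alpha> * (v - u) \<le> m v - m u}"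
  \<comment> \<open>Centre and radius, since the covering theorem speaks of closed balls.\<close>
  define c r :: "real \<times> real \<Rightarrow> real"
    where "c i = (fst i + snd i) / 2" and "r i = (snd i - fst i) / 2" for i
  define J where "J i = {fst i..snd i}" for i :: "real \<times> real"
  have cb: "cball (c i) (r i) = J i" for i
    by (simp add: c_def r_def J_def cball_eq_atLeastAtMost field_simps)
  have cover: "\<exists>i. i \<in> I \<and> x \<in> cball (c i) (r i) \<and> r i < d" if xd: "x \<in> E" "0 < d" for x d
  proof -
    obtain u v where "a \<le> u" "u < v" "v \<le> b" "x \<in> {u..v}" "v - u < d" "\<alpha> * (v - u) \<le> m v - m u"
      using E[OF xd] by blast
    then show ?thesis
      unfolding cb by (intro exI[of _ "(u, v)"]) (auto simp: I_def J_def r_def)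
  qed
  have pos: "0 < r i" if "i \<in> I" for i
    using that by (auto simp: I_def r_def)
  obtain C where C: "countable C" "C \<subseteq> I"
     "pairwise (\<lambda>i j. disjnt (cball (c i) (r i)) (cball (c j) (r j))) C"
     "negligible (E - (\<Union>i \<in> C. cball (c i) (r i)))"
    by (rule Vitali_covering_theorem_cballs[of I r E c, OF pos cover])
  have dj: "pairwise (\<lambda>i j. disjnt (J i) (J j)) C"
    using C(3) unfolding cb .
  have fin: "measure lebesgue (\<Union>i\<in>F. J i) \<le> (m b - m a) / \<alpha>" if F: "F \<subseteq> C" "finite F" for F
  proof -
    have FI: "F \<subseteq> I" using F C by blast
    have inj: "inj_on J F"
      using FI by (auto simp: inj_on_def I_def J_def Icc_eq_Icc)
    have "(J ` F) division_of (\<Union>(J ` F))"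
    proof (rule division_ofI)
      show "\<exists>a b. K = cbox a b" if "K \<in> J ` F" for K
        using that unfolding J_def by (auto simp flip: box_real(2))
      show "interior K1 \<inter> interior K2 = {}" if KK: "K1 \<in> J ` F" "K2 \<in> J ` F" "K1 \<noteq> K2" for K1 K2
      proof -
        obtain i j where ij: "i \<in> F" "K1 = J i" "j \<in> F" "K2 = J j" "i \<noteq> j"
          using KK by (auto simp: image_iff)
        have "disjnt (J i) (J j)"
          by (rule pairwiseD[OF dj]) (use ij F(1) in auto)
        then have "K1 \<inter> K2 = {}"
          unfolding ij disjnt_def .
        then show ?thesis
          using interior_subset[of K1] interior_subset[of K2] by blast
      qed
      show "K \<noteq> {}" if "K \<in> J ` F" for K
        using that FI by (fastforce simp: I_def J_def)
    qed (use F in auto)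
    moreover have "\<Union>(J ` F) \<subseteq> cbox a b"
      using FI by (force simp: I_def J_def)
    \<comment> \<open>Filling the gaps gives a full division, whose increments telescope; the added
      pieces contribute nonnegative terms.\<close>
    ultimately obtain q where q: "J ` F \<subseteq> q" "q division_of cbox a b"
      by (rule partial_division_extend_interval)
    have "measure lebesgue (\<Union>i\<in>F. J i) \<le> (\<Sum>i\<in>F. measure lebesgue (J i))"
      using F(2) by (intro measure_UNION_le) (auto simp: J_def)
    then have 1: "\<alpha> * measure lebesgue (\<Union>i\<in>F. J i) \<le> (\<Sum>i\<in>F. \<alpha> * measure lebesgue (J i))"
      using \<open>\<alpha> > 0\<close> by (simp flip: sum_distrib_left)
    have 2: "(\<Sum>i\<in>F. \<alpha> * measure lebesgue (J i)) \<le> (\<Sum>i\<in>F. m (Sup (J i)) - m (Inf (J i)))"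
    proof (rule sum_mono)
      fix i assume "i \<in> F"
      then obtain u v where "i = (u, v)" "u < v" "\<alpha> * (v - u) \<le> m v - m u"
        using FI by (auto simp: I_def)
      then show "\<alpha> * measure lebesgue (J i) \<le> m (Sup (J i)) - m (Inf (J i))"
        by (simp add: J_def)
    qed
    have 3: "(\<Sum>i\<in>F. m (Sup (J i)) - m (Inf (J i))) = (\<Sum>K\<in>J ` F. m (Sup K) - m (Inf K))"
      by (rule sum.reindex_cong[OF inj, symmetric]) auto
    have 4: "(\<Sum>K\<in>J ` F. m (Sup K) - m (Inf K)) \<le> (\<Sum>K\<in>q. m (Sup K) - m (Inf K))"
    proof (intro sum_mono2)
      show "0 \<le> m (Sup K) - m (Inf K)" if "K \<in> q - J ` F" for K
      proof -
        have "K \<in> q" using that by blast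
        then obtain u v where "K = {u..v}" "u \<le> v" "{u..v} \<subseteq> cbox a b"
          by (rule division_real_cases[OF q(2)])
        then show ?thesis using mono[of u v] by auto
      qed
    qed (use q in auto)
    have 5: "(\<Sum>K\<in>q. m (Sup K) - m (Inf K)) = m b - m a"
      using q(2) \<open>a \<le> b\<close> by (intro division_sum_telescope) auto
    show ?thesis
      using 1 2 3 4 5 \<open>\<alpha> > 0\<close> by (simp add: pos_le_divide_eq mult.commute)
  qed
  let ?U = "\<Union>i\<in>C. J i"
  have J: "\<And>i. i \<in> C \<Longrightarrow> J i \<in> lmeasurable" by (simp add: J_def)
  have U: "?U \<in> lmeasurable" "measure lebesgue ?U \<le> (m b - m a) / \<alpha>"
    by (rule fmeasurable_UN_bound[OF C(1) J fin] measure_UN_bound[OF C(1) J fin]; assumption)+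
  \<comment> \<open>The null set that the Vitali family misses is added back without changing the
    measure.\<close>
  let ?W = "?U \<union> (E - ?U)"
  have N: "negligible (E - ?U)" using C(4) unfolding cb .
  have "measure lebesgue ?W \<le> (m b - m a) / \<alpha>"
    using U(2) measure_Un_le[of ?U lebesgue "E - ?U"] U(1) N
    by (simp add: negligible_imp_measure0 negligible_imp_measurable fmeasurableD)
  moreover have "?W \<in> lmeasurable"
    using U(1) negligible_imp_measurable[OF N] by (rule fmeasurable.Un)
  ultimately show ?thesis
    using \<open>\<alpha> > 0\<close> by (intro bexI[of _ ?W]) (auto simp: field_simps)
qed

text \<open>\<open>T x\<close> is the supremum of the variation sums over divisions of
  \<open>{a..x}\<close>. Appending \<open>{u..v}\<close> to a division of \<open>{a..u}\<close>
  gives the first property, near-optimal divisions of \<open>{a..b}\<close> the second.\<close>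

lemma total_variation_exists:
  fixes h :: "real \<Rightarrow> real"
  assumes "a \<le> b"
    and bd: "\<forall>x\<in>{a..b}. \<forall>D. D division_of {a..x} \<longrightarrow> (\<Sum>K\<in>D. \<bar>h (Sup K) - h (Inf K)\<bar>) \<le> B"
  shows "\<exists>T. (\<forall>u v. a \<le> u \<longrightarrow> u \<le> v \<longrightarrow> v \<le> b \<longrightarrow> \<bar>h v - h u\<bar> \<le> T v - T u) \<and>
    (\<forall>e>0. \<exists>D. D division_of {a..b} \<and> T b - T a - e < (\<Sum>K\<in>D. \<bar>h (Sup K) - h (Inf K)\<bar>))"
proof -
  let ?s = "\<lambda>D. \<Sum>K\<in>D. \<bar>h (Sup K) - h (Inf K)\<bar>"
  define V where "V x = ?s ` {D. D division_of {a..x}}" for x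
  define T where "T x = Sup (V x)" for x
  have ne: "V x \<noteq> {}" if "a \<le> x" for x
  proof -
    have "{{a..x}} division_of {a..x}"
      using that division_of_self[of a x] by (simp add: box_real)
    then show ?thesis by (auto simp: V_def)
  qed
  have bdd: "bdd_above (V x)" if "x \<in> {a..b}" for x
    using bd that by (auto simp: V_def intro!: bdd_aboveI)
  show ?thesis
  proof (intro exI[of _ T] conjI allI impI)
    fix u v assume uv: "a \<le> u" "u \<le> v" "v \<le> b"
    show "\<bar>h v - h u\<bar> \<le> T v - T u"
    proof (cases "u = v")
      case False
      have "T u \<le> T v - \<bar>h v - h u\<bar>"
        unfolding T_def[of u]
      proof (rule cSup_least)
        show "V u \<noteq> {}" using ne uv by auto
        fix s assume "s \<in> V u"
        then obtain D where D: "D division_of {a..u}" "s = ?s D" by (auto simp: V_def)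
        have "(D \<union> {{u..v}}) division_of ({a..u} \<union> {u..v})"
          using D(1) division_of_self[of u v] uv
          by (intro division_disjoint_union) (auto simp: box_real)
        moreover have "{a..u} \<union> {u..v} = {a..v}" using uv by auto
        ultimately have "?s (insert {u..v} D) \<in> V v" by (auto simp: V_def)
        \<comment> \<open>As \<open>u < v\<close>, the new piece reaches beyond \<open>u\<close>; it
          is not yet in the set \<open>D\<close>, so its term really is added to the sum.\<close>
        moreover have "{u..v} \<notin> D"
          using division_ofD(2)[OF D(1), of "{u..v}"] uv False by auto
        moreover have "finite D" using D by auto
        ultimately have "\<bar>h v - h u\<bar> + s \<in> V v" using uv D by simp
        then have "\<bar>h v - h u\<bar> + s \<le> T v"
          unfolding T_def using bdd uv by (intro cSup_upper) auto
        then show "s \<le> T v - \<bar>h v - h u\<bar>" by simp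
      qed
      then show ?thesis by simp
    qed auto
  next
    fix e :: real assume "e > 0"
    \<comment> \<open>With this sign, a division that nearly attains \<open>T b\<close> also exceeds
      \<open>T b - T a - e\<close>.\<close>
    have "0 \<le> T a"
    proof -
      obtain s where "s \<in> V a" using ne by blast
      then show ?thesis
        unfolding T_def using bdd[of a] \<open>a \<le> b\<close>
        by (intro cSup_upper2[of s]) (auto simp: V_def sum_nonneg)
    qed
    then have "T b - T a - e < Sup (V b)" using \<open>e > 0\<close> by (simp add: T_def)
    then show "\<exists>D. D division_of {a..b} \<and> T b - T a - e < ?s D"
      using less_cSup_iff[OF ne bdd] \<open>a \<le> b\<close> by (auto simp: V_def)
  qed
qed


text \<open>Austin's argument: on a piece of a division that nearly attains the total variation \<open>T\<close>, secants
  whose sign is opposite to that of the chord increase the variation, so they cover little.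
  With \<open>s\<close> the sign of the chord, \<open>T - s h\<close> is monotone and grows little on the piece.\<close>

lemma opposite_secants_negligible:
  fixes h :: "real \<Rightarrow> real"
  assumes "a \<le> b"
    and bd: "\<forall>x\<in>{a..b}. \<forall>D. D division_of {a..x} \<longrightarrow> (\<Sum>K\<in>D. \<bar>h (Sup K) - h (Inf K)\<bar>) \<le> B"
    and "\<alpha> > 0" and Eab: "E \<subseteq> {a..b}"
    and up: "\<And>x d. x \<in> E \<Longrightarrow> 0 < d \<Longrightarrow>
      \<exists>u v. u < v \<and> x \<in> {u..v} \<and> v - u < d \<and> \<alpha> < (h v - h u) / (v - u)"
    and down: "\<And>x d. x \<in> E \<Longrightarrow> 0 < d \<Longrightarrow>
      \<exists>u v. u < v \<and> x \<in> {u..v} \<and> v - u < d \<and> (h v - h u) / (v - u) < - \<alpha>"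
  shows "negligible E"
  unfolding negligible_outer_le
proof (intro allI impI)
  fix e :: real assume "e > 0"
  obtain T where T: "\<forall>u v. a \<le> u \<longrightarrow> u \<le> v \<longrightarrow> v \<le> b \<longrightarrow> \<bar>h v - h u\<bar> \<le> T v - T u"
    and approx: "\<forall>e>0. \<exists>D. D division_of {a..b} \<and> T b - T a - e < (\<Sum>K\<in>D. \<bar>h (Sup K) - h (Inf K)\<bar>)"
    using total_variation_exists[OF \<open>a \<le> b\<close> bd] by blast
  \<comment> \<open>The pieces share a total excess below \<open>\<alpha> * e\<close>; dividing by
    the slope \<open>\<alpha>\<close> leaves measure at most \<open>e\<close>.\<close>
  obtain D where D: "D division_of {a..b}"
    and DT: "T b - T a - \<alpha> * e < (\<Sum>K\<in>D. \<bar>h (Sup K) - h (Inf K)\<bar>)"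
    using approx[rule_format, of "\<alpha> * e"] \<open>e > 0\<close> \<open>\<alpha> > 0\<close> by auto
  have "\<exists>W \<in> lmeasurable. E \<inter> {Inf K<..<Sup K} \<subseteq> W \<and>
      \<alpha> * measure lebesgue W \<le> (T (Sup K) - T (Inf K)) - \<bar>h (Sup K) - h (Inf K)\<bar>" if KD: "K \<in> D" for K
  proof -
    obtain p q where K: "K = {p..q}" "p \<le> q" "{p..q} \<subseteq> {a..b}"
      using division_real_cases[OF D KD] by blast
    then have pq: "a \<le> p" "q \<le> b" by auto
    define s :: real where "s = (if h p \<le> h q then 1 else - 1)"
    have s: "s * (h q - h p) = \<bar>h q - h p\<bar>" "s = 1 \<or> s = - 1" by (auto simp: s_def)
    define m where "m x = T x - s * h x" for x
    have "\<exists>W \<in> lmeasurable. E \<inter> {p<..<q} \<subseteq> W \<and> \<alpha> * measure lebesgue W \<le> m q - m p"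
    proof (rule monotone_steep_cover[where m = m and a = p and b = q])
      fix u v assume "p \<le> u" "u \<le> v" "v \<le> q"
      then show "m u \<le> m v"
        using T[rule_format, of u v] pq s(2) by (auto simp: m_def)
    next
      fix x d :: real assume x: "x \<in> E \<inter> {p<..<q}" and "0 < d"
      \<comment> \<open>Keeps the secant interval around \<open>x\<close> inside the piece
        \<open>{p..q}\<close>.\<close>
      define d' where "d' = min d (min (x - p) (q - x))"
      have "d' > 0" using x \<open>0 < d\<close> by (auto simp: d'_def)
      have "\<exists>u v. u < v \<and> x \<in> {u..v} \<and> v - u < d' \<and> s * (h v - h u) \<le> - (\<alpha> * (v - u))"
      proof (cases "s = 1")
        case True
        then show ?thesis
          using down[OF _ \<open>d' > 0\<close>, of x] x
          by (fastforce simp: pos_divide_less_eq)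
      next
        case False
        then have "s = - 1" using s(2) by blast
        then show ?thesis
          using up[OF _ \<open>d' > 0\<close>, of x] x
          by (fastforce simp: pos_less_divide_eq)
      qed
      then obtain u v where uv: "u < v" "x \<in> {u..v}" "v - u < d'"
        "s * (h v - h u) \<le> - (\<alpha> * (v - u))" by blast
      then have in_pq: "p \<le> u" "v \<le> q" "v - u < d" by (auto simp: d'_def)
      have "0 \<le> T v - T u" using T[rule_format, of u v] in_pq uv(1) pq by auto
      then have "\<alpha> * (v - u) \<le> m v - m u"
        using uv(4) by (simp add: m_def algebra_simps)
      then show "\<exists>u v. p \<le> u \<and> u < v \<and> v \<le> q \<and> x \<in> {u..v} \<and> v - u < d \<and> \<alpha> * (v - u) \<le> m v - m u"
        using uv in_pq by blast
    qed (use K \<open>\<alpha> > 0\<close> in auto)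
    moreover have "m q - m p = (T q - T p) - \<bar>h q - h p\<bar>"
      using s(1) by (simp add: m_def algebra_simps)
    ultimately show ?thesis
      using K by simp
  qed
  then obtain W where W: "\<And>K. K \<in> D \<Longrightarrow> W K \<in> lmeasurable"
    "\<And>K. K \<in> D \<Longrightarrow> E \<inter> {Inf K<..<Sup K} \<subseteq> W K"
    "\<And>K. K \<in> D \<Longrightarrow> \<alpha> * measure lebesgue (W K) \<le> (T (Sup K) - T (Inf K)) - \<bar>h (Sup K) - h (Inf K)\<bar>"
    by metis
  have fin: "finite D" using D by auto
  \<comment> \<open>The covers \<open>W K\<close> handle only the open pieces; the endpoints form a
    finite set.\<close>
  let ?P = "Inf ` D \<union> Sup ` D"
  let ?U = "\<Union>K\<in>D. W K"
  have P: "negligible ?P" using fin by (intro negligible_finite) auto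
  have U: "?U \<in> lmeasurable" using W(1) fin by (intro fmeasurable.finite_UN) auto
  have "\<alpha> * measure lebesgue ?U \<le> \<alpha> * (\<Sum>K\<in>D. measure lebesgue (W K))"
    using \<open>\<alpha> > 0\<close> fin W(1) by (intro mult_left_mono measure_UNION_le) auto
  also have "\<dots> \<le> (\<Sum>K\<in>D. (T (Sup K) - T (Inf K)) - \<bar>h (Sup K) - h (Inf K)\<bar>)"
    unfolding sum_distrib_left using W(3) by (rule sum_mono)
  also have "\<dots> = (T b - T a) - (\<Sum>K\<in>D. \<bar>h (Sup K) - h (Inf K)\<bar>)"
    unfolding sum_subtractf[of "\<lambda>K. T (Sup K) - T (Inf K)"] division_sum_telescope[OF D \<open>a \<le> b\<close>] ..
  also have "\<dots> \<le> \<alpha> * e" using DT by simp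
  finally have "measure lebesgue ?U \<le> e" using \<open>\<alpha> > 0\<close> by simp
  moreover have "measure lebesgue (?U \<union> ?P) \<le> measure lebesgue ?U + measure lebesgue ?P"
    using U P by (intro measure_Un_le) (auto simp: negligible_imp_sets)
  ultimately have "measure lebesgue (?U \<union> ?P) \<le> e"
    using P by (simp add: negligible_imp_measure0)
  moreover have "?U \<union> ?P \<in> lmeasurable"
    using U negligible_imp_measurable[OF P] by (rule fmeasurable.Un)
  moreover have "E \<subseteq> ?U \<union> ?P"
  proof
    fix x assume "x \<in> E"
    then obtain K where K: "K \<in> D" "x \<in> K"
      using Eab division_ofD(6)[OF D] by blast
    obtain p q where pq: "K = {p..q}" "p \<le> q"
      using division_real_cases[OF D K(1)] by blast
    then have "x = Inf K \<or> x = Sup K \<or> x \<in> {Inf K<..<Sup K}"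
      using K(2) by auto
    then show "x \<in> ?U \<union> ?P"
      using W(2)[OF K(1)] K(1) \<open>x \<in> E\<close> by blast
  qed
  ultimately show "\<exists>S. E \<subseteq> S \<and> S \<in> lmeasurable \<and> measure lebesgue S \<le> e"
    by blast
qed

text \<open>The total variation \<open>T\<close> is at least as steep as \<open>h\<close>, so for
  every \<open>N\<close> the set is covered by measure at most
  \<open>(T b - T a) / N\<close>.\<close>

lemma unbounded_secants_negligible:
  fixes h :: "real \<Rightarrow> real"
  assumes "a \<le> b"
    and bd: "\<forall>x\<in>{a..b}. \<forall>D. D division_of {a..x} \<longrightarrow> (\<Sum>K\<in>D. \<bar>h (Sup K) - h (Inf K)\<bar>) \<le> B"
    and Eab: "E \<subseteq> {a<..<b}"
    and steep: "\<And>x d N. x \<in> E \<Longrightarrow> 0 < d \<Longrightarrow>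
      \<exists>u v. u < v \<and> x \<in> {u..v} \<and> v - u < d \<and> N < \<bar>(h v - h u) / (v - u)\<bar>"
  shows "negligible E"
  unfolding negligible_outer_le
proof (intro allI impI)
  fix e :: real assume "e > 0"
  obtain T where T: "\<forall>u v. a \<le> u \<longrightarrow> u \<le> v \<longrightarrow> v \<le> b \<longrightarrow> \<bar>h v - h u\<bar> \<le> T v - T u"
    using total_variation_exists[OF \<open>a \<le> b\<close> bd] by blast
  have Tab: "0 \<le> T b - T a" using T[rule_format, of a b] \<open>a \<le> b\<close> by auto
  \<comment> \<open>Adding 1 keeps \<open>N\<close> positive when the variation is zero.\<close>
  define N where "N = (T b - T a + 1) / e"
  have "N > 0" using Tab \<open>e > 0\<close> by (simp add: N_def)
  have "\<exists>W \<in> lmeasurable. E \<subseteq> W \<and> N * measure lebesgue W \<le> T b - T a"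
  proof (rule monotone_steep_cover[where m = T and a = a and b = b])
    fix u v assume "a \<le> u" "u \<le> v" "v \<le> b"
    then show "T u \<le> T v"
      using T[rule_format, of u v] by auto
  next
    fix x d :: real assume x: "x \<in> E" and "0 < d"
    define d' where "d' = min d (min (x - a) (b - x))"
    have "d' > 0" using x Eab \<open>0 < d\<close> by (auto simp: d'_def)
    then obtain u v where uv: "u < v" "x \<in> {u..v}" "v - u < d'" "N < \<bar>(h v - h u) / (v - u)\<bar>"
      using steep[OF x, of d' N] by blast
    then have in_ab: "a \<le> u" "v \<le> b" "v - u < d" by (auto simp: d'_def)
    have "N * (v - u) \<le> \<bar>h v - h u\<bar>"
      using uv(1,4) by (simp add: pos_less_divide_eq)
    then have "N * (v - u) \<le> T v - T u"
      using T[rule_format, of u v] uv(1) in_ab by auto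
    then show "\<exists>u v. a \<le> u \<and> u < v \<and> v \<le> b \<and> x \<in> {u..v} \<and> v - u < d \<and> N * (v - u) \<le> T v - T u"
      using uv in_ab by blast
  qed (use \<open>a \<le> b\<close> \<open>N > 0\<close> in auto)
  then obtain W where W: "W \<in> lmeasurable" "E \<subseteq> W" "N * measure lebesgue W \<le> T b - T a" by blast
  have "N * measure lebesgue W \<le> N * e"
    using W(3) \<open>e > 0\<close> by (simp add: N_def)
  then have "measure lebesgue W \<le> e" using \<open>N > 0\<close> by simp
  then show "\<exists>S. E \<subseteq> S \<and> S \<in> lmeasurable \<and> measure lebesgue S \<le> e"
    using W by blast
qed

text \<open>Brings difference quotients at \<open>x\<close>, from either side, into the form of the
  covering arguments: secants over short intervals that contain \<open>x\<close>.\<close>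

lemma secant_interval:
  fixes h :: "real \<Rightarrow> real"
  assumes "z \<noteq> x" "\<bar>z - x\<bar> < d" "P ((h z - h x) / (z - x))"
  shows "\<exists>u v. u < v \<and> x \<in> {u..v} \<and> v - u < d \<and> P ((h v - h u) / (v - u))"
proof (cases "x < z")
  case True
  then show ?thesis using assms by (intro exI[of _ x] exI[of _ z]) auto
next
  case False
  moreover have "(h z - h x) / (z - x) = (h x - h z) / (x - z)"
    by (metis minus_diff_eq minus_divide_divide)
  ultimately show ?thesis using assms by (intro exI[of _ z] exI[of _ x]) auto
qed

text \<open>If \<open>h\<close> is not differentiable at \<open>x\<close>, then either its secants
  near \<open>x\<close> are unbounded, or the lower and upper limits of its difference quotients are
  separated by rationals \<open>p < q\<close>. The second case leaves countably many sets
  \<open>E p q\<close>.\<close>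

lemma bounded_variation_AE_differentiable:
  fixes h :: "real \<Rightarrow> real"
  assumes "a \<le> b"
    and bd: "\<forall>x\<in>{a..b}. \<forall>D. D division_of {a..x} \<longrightarrow> (\<Sum>K\<in>D. \<bar>h (Sup K) - h (Inf K)\<bar>) \<le> B"
  shows "negligible {x \<in> {a<..<b}. \<nexists>D. (h has_real_derivative D) (at x)}"
proof -
  define Einf where "Einf = {x \<in> {a<..<b}. \<forall>d>0. \<forall>N.
      \<exists>u v. u < v \<and> x \<in> {u..v} \<and> v - u < d \<and> N < \<bar>(h v - h u) / (v - u)\<bar>}"
  define E where "E p q = {x \<in> {a<..<b}.
      (\<forall>d>0. \<exists>u v. u < v \<and> x \<in> {u..v} \<and> v - u < d \<and> (h v - h u) / (v - u) < p) \<and>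
      (\<forall>d>0. \<exists>u v. u < v \<and> x \<in> {u..v} \<and> v - u < d \<and> q < (h v - h u) / (v - u))}" for p q
  have "negligible Einf"
    by (rule unbounded_secants_negligible[OF \<open>a \<le> b\<close> bd]) (auto simp: Einf_def)
  moreover have "negligible (E p q)" if "p < q" for p q
  proof -
    \<comment> \<open>Subtracting the line of slope \<open>r\<close> moves slopes below
      \<open>p\<close> and above \<open>q\<close> to opposite sides of zero, at distance more than
      \<open>(q - p) / 2\<close>, and adds at most \<open>\<bar>r\<bar> * (b - a)\<close> to the
      variation.\<close>
    define r where "r = (p + q) / 2"
    define k where "k x = h x - r * x" for x
    have slope: "(k v - k u) / (v - u) = (h v - h u) / (v - u) - r" if "u < v" for u v
      using that by (simp add: k_def field_simps)
    have kbd: "\<forall>x\<in>{a..b}. \<forall>D. D division_of {a..x} \<longrightarrow>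
      (\<Sum>K\<in>D. \<bar>k (Sup K) - k (Inf K)\<bar>) \<le> B + \<bar>r\<bar> * (b - a)"
    proof (intro ballI allI impI)
      fix x D assume x: "x \<in> {a..b}" "D division_of {a..x}"
      have "\<bar>k (Sup K) - k (Inf K)\<bar> \<le> \<bar>h (Sup K) - h (Inf K)\<bar> + \<bar>r\<bar> * (Sup K - Inf K)" if KD: "K \<in> D" for K
      proof -
        obtain u v where K: "K = {u..v}" "u \<le> v"
          using division_real_cases[OF x(2) KD] by blast
        have "\<bar>k v - k u\<bar> = \<bar>(h v - h u) - r * (v - u)\<bar>"
          by (simp add: k_def algebra_simps)
        also have "\<dots> \<le> \<bar>h v - h u\<bar> + \<bar>r\<bar> * (v - u)"
          using K(2) abs_triangle_ineq4[of "h v - h u" "r * (v - u)"] by (simp add: abs_mult)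
        finally show ?thesis using K by simp
      qed
      then have "(\<Sum>K\<in>D. \<bar>k (Sup K) - k (Inf K)\<bar>)
          \<le> (\<Sum>K\<in>D. \<bar>h (Sup K) - h (Inf K)\<bar>) + \<bar>r\<bar> * (\<Sum>K\<in>D. Sup K - Inf K)"
        unfolding sum_distrib_left sum.distrib[symmetric] by (rule sum_mono)
      also have "(\<Sum>K\<in>D. Sup K - Inf K) = x - a"
        using division_sum_telescope[OF x(2), of "\<lambda>x. x"] x(1) by simp
      also have "(\<Sum>K\<in>D. \<bar>h (Sup K) - h (Inf K)\<bar>) + \<bar>r\<bar> * (x - a) \<le> B + \<bar>r\<bar> * (b - a)"
        using bd x by (intro add_mono mult_left_mono) auto
      finally show "(\<Sum>K\<in>D. \<bar>k (Sup K) - k (Inf K)\<bar>) \<le> B + \<bar>r\<bar> * (b - a)" .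
    qed
    have sh: "c < y - r \<longleftrightarrow> c + r < y" "y - r < c \<longleftrightarrow> y < c + r" for c y :: real by auto
    show ?thesis
    proof (rule opposite_secants_negligible[OF \<open>a \<le> b\<close> kbd, where \<alpha> = "(q - p) / 2"])
      fix x d :: real assume "x \<in> E p q" "0 < d"
      then obtain u v where "u < v" "x \<in> {u..v}" "v - u < d" "q < (h v - h u) / (v - u)"
        unfolding E_def by blast
      then show "\<exists>u v. u < v \<and> x \<in> {u..v} \<and> v - u < d \<and> (q - p) / 2 < (k v - k u) / (v - u)"
        by (intro exI[of _ u] exI[of _ v]) (auto simp: slope sh r_def field_simps)
    next
      fix x d :: real assume "x \<in> E p q" "0 < d"
      then obtain u v where "u < v" "x \<in> {u..v}" "v - u < d" "(h v - h u) / (v - u) < p"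
        unfolding E_def by blast
      then show "\<exists>u v. u < v \<and> x \<in> {u..v} \<and> v - u < d \<and> (k v - k u) / (v - u) < - ((q - p) / 2)"
        by (intro exI[of _ u] exI[of _ v]) (auto simp: slope sh r_def field_simps)
    qed (use that in \<open>auto simp: E_def\<close>)
  qed
  then have "negligible (\<Union>(p, q)\<in>{(p, q). p \<in> \<rat> \<and> q \<in> \<rat> \<and> p < q}. E p q)"
    by (intro negligible_countable_Union countable_image)
      (auto intro: countable_subset[OF _ countable_SIGMA[OF countable_rat countable_rat]])
  ultimately have neg: "negligible (Einf \<union> (\<Union>(p, q)\<in>{(p, q). p \<in> \<rat> \<and> q \<in> \<rat> \<and> p < q}. E p q))"
    by (rule negligible_Un)
  show ?thesis
  proof (rule negligible_subset[OF neg], rule subsetI, rule ccontr)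
    fix x assume x: "x \<in> {x \<in> {a<..<b}. \<nexists>D. (h has_real_derivative D) (at x)}"
      and notin: "x \<notin> Einf \<union> (\<Union>(p, q)\<in>{(p, q). p \<in> \<rat> \<and> q \<in> \<rat> \<and> p < q}. E p q)"
    let ?q = "\<lambda>z. (h z - h x) / (z - x)"
    define Q where "Q z = ereal (?q z)" for z
    obtain d0 N where d0: "d0 > 0"
      "\<nexists>u v. u < v \<and> x \<in> {u..v} \<and> v - u < d0 \<and> N < \<bar>(h v - h u) / (v - u)\<bar>"
      using x notin unfolding Einf_def by blast
    have "eventually (\<lambda>z. \<bar>?q z\<bar> \<le> N) (at x)"
      unfolding eventually_at
    proof (intro exI[of _ d0] conjI ballI impI)
      fix z assume z: "z \<noteq> x \<and> dist z x < d0"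
      show "\<bar>?q z\<bar> \<le> N"
      proof (rule ccontr)
        assume "\<not> \<bar>?q z\<bar> \<le> N"
        then show False
          using secant_interval[of z x d0 "\<lambda>c. N < \<bar>c\<bar>" h] z d0(2)
          by (simp add: dist_real_def not_le)
      qed
    qed (use d0 in auto)
    then have "eventually (\<lambda>z. ereal (- N) \<le> Q z) (at x)" "eventually (\<lambda>z. Q z \<le> ereal N) (at x)"
      by (auto simp: Q_def abs_le_iff simp del: abs_divide elim!: eventually_mono)
    then have bounds: "ereal (- N) \<le> Liminf (at x) Q" "Limsup (at x) Q \<le> ereal N"
      using Liminf_bounded Limsup_bounded by blast+
    have "Limsup (at x) Q \<le> Liminf (at x) Q"
    proof (rule ccontr)
      assume "\<not> ?thesis"
      then obtain p where p: "Liminf (at x) Q < ereal p" "ereal p < Limsup (at x) Q" "p \<in> \<rat>"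
        using ereal_dense3[of "Liminf (at x) Q" "Limsup (at x) Q"] by (metis Rats_of_rat not_le)
      obtain q where q: "ereal p < ereal q" "ereal q < Limsup (at x) Q" "q \<in> \<rat>"
        using ereal_dense3[OF p(2)] by (metis Rats_of_rat)
      have "x \<in> E p q"
        unfolding E_def
      proof (intro CollectI conjI allI impI)
        fix d :: real assume "d > 0"
        show "\<exists>u v. u < v \<and> x \<in> {u..v} \<and> v - u < d \<and> (h v - h u) / (v - u) < p"
        proof (rule ccontr)
          assume no: "\<not> ?thesis"
          have "eventually (\<lambda>z. ereal p \<le> Q z) (at x)"
            unfolding eventually_at Q_def
          proof (intro exI[of _ d] conjI ballI impI \<open>d > 0\<close>)
            fix z assume z: "z \<noteq> x \<and> dist z x < d"
            show "ereal p \<le> ereal (?q z)"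
              using secant_interval[of z x d "\<lambda>c. c < p" h] no z
              by (simp add: dist_real_def) (meson not_le)
          qed
          then have "ereal p \<le> Liminf (at x) Q" by (rule Liminf_bounded)
          then show False using p by simp
        qed
      next
        fix d :: real assume "d > 0"
        show "\<exists>u v. u < v \<and> x \<in> {u..v} \<and> v - u < d \<and> q < (h v - h u) / (v - u)"
        proof (rule ccontr)
          assume no: "\<not> ?thesis"
          have "eventually (\<lambda>z. Q z \<le> ereal q) (at x)"
            unfolding eventually_at Q_def
          proof (intro exI[of _ d] conjI ballI impI \<open>d > 0\<close>)
            fix z assume z: "z \<noteq> x \<and> dist z x < d"
            show "ereal (?q z) \<le> ereal q"
              using secant_interval[of z x d "\<lambda>c. q < c" h] no z
              by (simp add: dist_real_def) (meson not_le)
          qed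
          then have "Limsup (at x) Q \<le> ereal q" by (rule Limsup_bounded)
          then show False using q by simp
        qed
      qed (use x in auto)
      then show False using notin p(3) q by auto
    qed
    then have eq: "Liminf (at x) Q = Limsup (at x) Q"
      by (simp add: antisym Liminf_le_Limsup)
    obtain L where L: "Limsup (at x) Q = ereal L"
      using bounds unfolding eq by (cases "Limsup (at x) Q") auto
    have "(Q \<longlongrightarrow> ereal L) (at x)"
      using eq L tendsto_iff_Liminf_eq_Limsup[of "at x" Q "ereal L"] by simp
    then have "(?q \<longlongrightarrow> L) (at x)" unfolding Q_def[abs_def] by simp
    then have "(h has_real_derivative L) (at x)" by (simp add: has_field_derivative_iff)
    then show False using x by blast
  qed
qed


text \<open>Absolute continuity with tolerance 1 bounds the variation by 1 on each of
  \<open>n\<close> pieces shorter than \<open>d\<close>. The grid points, including 0 and 1, go into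
  the null set: the derivative is two-sided, and nothing constrains \<open>g\<close> outside the
  unit interval.\<close>

lemma absolutely_continuous_AE_differentiable:
  fixes g :: "real \<Rightarrow> real"
  assumes "absolutely_continuous_fun_on {0..1} g"
  shows "AE t in lebesgue_on {0..1}. \<exists>v. (g has_real_derivative v) (at t)"
proof -
  obtain d where d: "d > 0"
    "\<And>D T. D division_of T \<Longrightarrow> T \<subseteq> {0..1} \<Longrightarrow> (\<Sum>K\<in>D. measure lborel K) < d \<Longrightarrow>
       (\<Sum>K\<in>D. norm (g (Sup K) - g (Inf K))) < 1"
    using assms unfolding absolutely_continuous_fun_on_def by (metis zero_less_one)
  obtain n :: nat where n: "1 / d < real n" using reals_Archimedean2 by blast
  have "n > 0" using n \<open>d > 0\<close> by (auto intro!: gr0I dest: order.strict_trans[of 0 "1 / d" 0])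
  then have nd: "1 / real n < d" using n \<open>d > 0\<close> by (simp add: field_simps)
  let ?B = "\<lambda>k. {x \<in> {real k / n<..<(real k + 1) / n}. \<nexists>D. (g has_real_derivative D) (at x)}"
  have "negligible (?B k)" if "k < n" for k
  proof (rule bounded_variation_AE_differentiable[where B = 1], goal_cases)
    case 1
    then show ?case using \<open>n > 0\<close> by (simp add: divide_right_mono)
  next
    case 2
    show ?case
    proof (intro ballI allI impI)
      fix x D assume x: "x \<in> {real k / real n..(real k + 1) / real n}"
        and D: "D division_of {real k / real n..x}"
      have "(real k + 1) / n \<le> 1" using that by simp
      then have sub: "{real k / real n..x} \<subseteq> {0..1}" using x by auto
      have "(\<Sum>K\<in>D. measure lborel K) = (\<Sum>K\<in>D. Sup K - Inf K)"
      proof (rule sum.cong)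
        fix K assume "K \<in> D"
        then obtain u v where "K = {u..v}" "u \<le> v"
          using division_real_cases[OF D] by blast
        then show "measure lborel K = Sup K - Inf K" by simp
      qed simp
      also have "\<dots> = x - real k / n"
        using division_sum_telescope[OF D, of "\<lambda>x. x"] x by simp
      also have "\<dots> \<le> 1 / n"
        using x by (simp add: add_divide_distrib)
      finally have "(\<Sum>K\<in>D. measure lborel K) < d"
        using nd by linarith
      from d(2)[OF D sub this] show "(\<Sum>K\<in>D. \<bar>g (Sup K) - g (Inf K)\<bar>) \<le> 1"
        by simp
    qed
  qed
  then have "negligible (\<Union>k<n. ?B k)"
    by (intro negligible_Union) auto
  moreover have "negligible ((\<lambda>k. real k / n) ` {..n})"
    by (intro negligible_finite) auto
  ultimately have "negligible ((\<Union>k<n. ?B k) \<union> (\<lambda>k. real k / n) ` {..n})"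
    by (rule negligible_Un)
  moreover have "{t \<in> {0..1}. \<nexists>v. (g has_real_derivative v) (at t)}
    \<subseteq> (\<Union>k<n. ?B k) \<union> (\<lambda>k. real k / n) ` {..n}"
  proof
    fix t assume "t \<in> {t \<in> {0..1}. \<nexists>v. (g has_real_derivative v) (at t)}"
    then have t: "0 \<le> t" "t \<le> 1" "\<nexists>v. (g has_real_derivative v) (at t)" by auto
    define k where "k = nat \<lfloor>t * n\<rfloor>"
    have k: "real k \<le> t * n" "t * n < real k + 1"
      using t(1) \<open>n > 0\<close> by (simp_all add: k_def)
    show "t \<in> (\<Union>k<n. ?B k) \<union> (\<lambda>k. real k / n) ` {..n}"
    proof (cases "real k = t * n")
      case True
      then have "t = real k / n" using \<open>n > 0\<close> by simp
      moreover have "k \<le> n"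
        using t(2) True \<open>n > 0\<close> by (metis mult_left_le_one_le of_nat_0_le_iff of_nat_le_iff t(1))
      ultimately show ?thesis by auto
    next
      case False
      have "t * n \<le> n" using t by (simp add: mult_left_le_one_le)
      then have "k < n" using k False by linarith
      moreover have "t \<in> ?B k"
        using k False t(3) \<open>n > 0\<close> by (simp add: pos_divide_less_eq pos_less_divide_eq)
      ultimately show ?thesis by blast
    qed
  qed
  ultimately have "negligible {t \<in> {0..1}. \<nexists>v. (g has_real_derivative v) (at t)}"
    using negligible_subset by blast
  then have "{t \<in> {0..1}. \<nexists>v. (g has_real_derivative v) (at t)} \<in> null_sets (lebesgue_on {0..1})"
    by (auto simp: null_sets_restrict_space negligible_iff_null_sets)
  then show ?thesis
    by (rule AE_I') (auto simp: space_restrict_space)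
qed

section \<open>Optimality conditions for the Lasso\<close>

definition lasso_corr :: "real^'p^'n \<Rightarrow> real^'n \<Rightarrow> real^'p \<Rightarrow> real^'p" where
  "lasso_corr X y b = transpose X *v (y - X *v b)"

abbreviation l1_norm :: "real^'p \<Rightarrow> real" where
  "l1_norm b \<equiv> \<Sum>i\<in>UNIV. \<bar>b $ i\<bar>"

text \<open>Stated in the penalty level \<open>\<mu>\<close>, not in its logarithm: for a fixed sign
  vector these are convex conditions on the pair \<open>(\<mu>, b)\<close>, so solutions at
  different levels can be mixed.\<close>

definition lasso_kkt :: "real^'p^'n \<Rightarrow> real^'n \<Rightarrow> real \<Rightarrow> real^'p \<Rightarrow> bool" where
  "lasso_kkt X y \<mu> b \<longleftrightarrow>
     (\<forall>i. \<bar>lasso_corr X y b $ i\<bar> \<le> \<mu> \<and> (b $ i \<noteq> 0 \<longrightarrow> lasso_corr X y b $ i = \<mu> * sgn (b $ i)))"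

lemma transpose_mult_inner: "(transpose X *v r) \<bullet> h = r \<bullet> (X *v h)" for X :: "real^'p^'n"
  by (simp add: transpose_matrix_vector dot_lmul_matrix)

lemma lasso_corr_inner: "lasso_corr X y b \<bullet> h = (y - X *v b) \<bullet> (X *v h)"
  unfolding lasso_corr_def by (rule transpose_mult_inner)

lemma lasso_corr_component: "lasso_corr X y b $ j = column j X \<bullet> (y - X *v b)"
  unfolding lasso_corr_def
  by (simp add: column_def transpose_def matrix_vector_mult_def inner_vec_def del: transpose_matrix_vector)

text \<open>Together with \<open>lasso_kkt_inner_le\<close> this is the subgradient inequality in
  two halves: equality at \<open>b\<close> itself, a Hoelder bound at every other point.\<close>

lemma lasso_kkt_inner_self:
  assumes "lasso_kkt X y \<mu> b"
  shows "lasso_corr X y b \<bullet> b = \<mu> * l1_norm b"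
proof -
  have "lasso_corr X y b $ i * b $ i = \<mu> * \<bar>b $ i\<bar>" for i
    using assms unfolding lasso_kkt_def by (cases "b $ i = 0") (auto simp: sgn_if)
  then show ?thesis by (simp add: inner_vec_def sum_distrib_left)
qed

lemma lasso_kkt_inner_le:
  assumes "lasso_kkt X y \<mu> b"
  shows "lasso_corr X y b \<bullet> b' \<le> \<mu> * l1_norm b'"
proof -
  have "lasso_corr X y b $ i * b' $ i \<le> \<mu> * \<bar>b' $ i\<bar>" for i
  proof -
    have "lasso_corr X y b $ i * b' $ i \<le> \<bar>lasso_corr X y b $ i\<bar> * \<bar>b' $ i\<bar>"
      by (metis abs_ge_self abs_mult)
    also have "\<dots> \<le> \<mu> * \<bar>b' $ i\<bar>"
      using assms unfolding lasso_kkt_def by (intro mult_right_mono) auto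
    finally show ?thesis .
  qed
  then show ?thesis
    by (simp add: inner_vec_def sum_distrib_left sum_mono)
qed

lemma lasso_objective_add:
  fixes X :: "real^'p^'n"
  shows
  "lasso_objective X y l (b + h) = lasso_objective X y l b - lasso_corr X y b \<bullet> h
     + 1/2 * (norm (X *v h))\<^sup>2 + exp l * (l1_norm (b + h) - l1_norm b)"
proof -
  have "y - X *v (b + h) = (y - X *v b) - X *v h"
    by (simp add: matrix_vector_right_distrib)
  moreover have "(norm (r - v))\<^sup>2 = (norm r)\<^sup>2 - 2 * (r \<bullet> v) + (norm v)\<^sup>2" for r v :: "real^'n"
    unfolding power2_norm_eq_inner by (simp add: inner_diff_left inner_diff_right inner_commute)
  ultimately have "(norm (y - X *v (b + h)))\<^sup>2 =
      (norm (y - X *v b))\<^sup>2 - 2 * (lasso_corr X y b \<bullet> h) + (norm (X *v h))\<^sup>2"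
    unfolding lasso_corr_inner by metis
  then show ?thesis
    unfolding lasso_objective_def by (simp add: algebra_simps)
qed

text \<open>As \<open>s\<close> tends to 0 the quadratic term is negligible, so the one-sided slopes
  at 0 must be nonnegative in both directions. Away from the kink of the absolute value the two
  conditions merge into an equation.\<close>

lemma quadratic_abs_minimum:
  fixes c K \<mu> \<beta> :: real
  assumes "\<And>s. 0 \<le> - (s * c) + K * s\<^sup>2 + \<mu> * (\<bar>\<beta> + s\<bar> - \<bar>\<beta>\<bar>)" and "K \<ge> 0" "\<mu> > 0"
  shows "\<bar>c\<bar> \<le> \<mu> \<and> (\<beta> \<noteq> 0 \<longrightarrow> c = \<mu> * sgn \<beta>)"
proof -
  have le: "a \<le> 0" if "\<And>s. 0 < s \<Longrightarrow> s < d \<Longrightarrow> s * a \<le> K * s\<^sup>2" "0 < d" for a d :: real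
  proof (rule ccontr)
    assume "\<not> a \<le> 0"
    then have "0 < a" by simp
    \<comment> \<open>Admissible and so small that \<open>K * s < a\<close>; \<open>K + 1\<close>
      covers the case \<open>K = 0\<close>.\<close>
    define s where "s = min (d / 2) (a / (2 * (K + 1)))"
    have s: "0 < s" "s < d" using \<open>0 < a\<close> \<open>0 < d\<close> \<open>K \<ge> 0\<close> by (auto simp: s_def min_less_iff_disj)
    have "a \<le> K * s" using that(1)[OF s] s(1) by (simp add: power2_eq_square)
    also have "\<dots> \<le> (K + 1) * (a / (2 * (K + 1)))"
      using \<open>K \<ge> 0\<close> s(1) by (intro mult_mono) (auto simp: s_def)
    also have "\<dots> < a" using \<open>K \<ge> 0\<close> \<open>0 < a\<close> by (simp add: field_simps add_pos_nonneg)
    finally show False by simp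
  qed
  have sg: "s * c \<le> K * s\<^sup>2 + \<mu> * (\<bar>\<beta> + s\<bar> - \<bar>\<beta>\<bar>)" for s
    using assms(1)[of s] by simp
  have tri: "\<mu> * (\<bar>\<beta> + s\<bar> - \<bar>\<beta>\<bar>) \<le> \<mu> * \<bar>s\<bar>" for s
    using \<open>\<mu> > 0\<close> by (intro mult_left_mono) auto
  have "c - \<mu> \<le> 0"
  proof (rule le[of 1])
    fix s :: real assume "0 < s"
    then show "s * (c - \<mu>) \<le> K * s\<^sup>2"
      using sg[of s] tri[of s] by (simp add: algebra_simps)
  qed simp
  moreover have "- c - \<mu> \<le> 0"
  proof (rule le[of 1])
    fix s :: real assume "0 < s"
    then show "s * (- c - \<mu>) \<le> K * s\<^sup>2"
      using sg[of "- s"] tri[of "- s"] by (simp add: algebra_simps)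
  qed simp
  moreover have "\<mu> - c \<le> 0" if "\<beta> > 0"
  proof (rule le[OF _ that])
    fix s assume "0 < s" "s < \<beta>"
    then show "s * (\<mu> - c) \<le> K * s\<^sup>2" using sg[of "- s"] by (simp add: algebra_simps)
  qed
  moreover have "\<mu> + c \<le> 0" if "\<beta> < 0"
  proof (rule le[of "- \<beta>"])
    fix s assume "0 < s" "s < - \<beta>"
    then show "s * (\<mu> + c) \<le> K * s\<^sup>2" using sg[of s] by (simp add: algebra_simps)
  qed (use that in simp)
  ultimately show ?thesis by (auto simp: sgn_if)
qed

lemma lasso_argmin_iff_kkt: "b \<in> lasso_argmin X y l \<longleftrightarrow> lasso_kkt X y (exp l) b"
proof
  assume kkt: "lasso_kkt X y (exp l) b"
  have "lasso_objective X y l b \<le> lasso_objective X y l b'" for b'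
  proof -
    have "lasso_corr X y b \<bullet> (b' - b) \<le> exp l * (l1_norm b' - l1_norm b)"
      using lasso_kkt_inner_self[OF kkt] lasso_kkt_inner_le[OF kkt, of b']
      by (simp add: inner_diff_right right_diff_distrib)
    then show ?thesis
      using lasso_objective_add[of X y l b "b' - b"]
      by (simp, use zero_le_power2[of "norm (X *v (b' - b))"] in linarith)
  qed
  then show "b \<in> lasso_argmin X y l"
    by (auto simp: lasso_argmin_def is_arg_min_linorder)
next
  assume "b \<in> lasso_argmin X y l"
  then have min: "lasso_objective X y l b \<le> lasso_objective X y l b'" for b'
    by (auto simp: lasso_argmin_def is_arg_min_linorder)
  show "lasso_kkt X y (exp l) b"
    unfolding lasso_kkt_def
  proof
    fix i
    show "\<bar>lasso_corr X y b $ i\<bar> \<le> exp l \<and> (b $ i \<noteq> 0 \<longrightarrow> lasso_corr X y b $ i = exp l * sgn (b $ i))"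
    \<comment> \<open>The coefficient of \<open>s\<^sup>2\<close> when only coordinate
      \<open>i\<close> is perturbed.\<close>
    proof (rule quadratic_abs_minimum[where K = "1/2 * (norm (X *v axis i 1))\<^sup>2"])
      fix s :: real
      have "l1_norm (b + s *\<^sub>R axis i 1) - l1_norm b = (\<Sum>j\<in>UNIV. if j = i then \<bar>b $ i + s\<bar> - \<bar>b $ i\<bar> else 0)"
        unfolding sum_subtractf[symmetric] by (intro sum.cong) (auto simp: axis_def)
      then have "l1_norm (b + s *\<^sub>R axis i 1) - l1_norm b = \<bar>b $ i + s\<bar> - \<bar>b $ i\<bar>" by simp
      then show "0 \<le> - (s * lasso_corr X y b $ i) + 1/2 * (norm (X *v axis i 1))\<^sup>2 * s\<^sup>2
          + exp l * (\<bar>b $ i + s\<bar> - \<bar>b $ i\<bar>)"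
        using min[of "b + s *\<^sub>R axis i 1"] lasso_objective_add[of X y l b "s *\<^sub>R axis i 1"]
        by (simp add: inner_axis power_mult_distrib matrix_vector_mult_scaleR mult.commute)
    qed auto
  qed
qed

lemma lasso_argmin_nonempty: "lasso_argmin X y l \<noteq> {}"
proof -
  let ?f = "lasso_objective X y l"
  \<comment> \<open>Outside this radius the penalty alone exceeds the objective at 0, so a minimizer
    over the ball is global.\<close>
  define R where "R = ?f 0 / exp l"
  have "0 \<le> ?f 0" by (simp add: lasso_objective_def)
  then have "R \<ge> 0" by (simp add: R_def)
  have "continuous_on (cball 0 R) ?f"
    unfolding lasso_objective_def
    by (intro continuous_intros matrix_vector_mult_linear_continuous_on)
  then obtain b where b: "b \<in> cball 0 R" "\<And>b'. b' \<in> cball 0 R \<Longrightarrow> ?f b \<le> ?f b'"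
    using continuous_attains_inf[of "cball 0 R" ?f] \<open>R \<ge> 0\<close> by auto
  have "?f b \<le> ?f b'" for b'
  proof (cases "b' \<in> cball 0 R")
    case False
    then have "R < norm b'" by simp
    also have "\<dots> \<le> l1_norm b'" by (rule norm_le_l1_cart)
    finally have "?f 0 < exp l * l1_norm b'" by (simp add: R_def field_simps)
    also have "\<dots> \<le> ?f b'" by (simp add: lasso_objective_def)
    finally show ?thesis using b(2)[of 0] \<open>R \<ge> 0\<close> by simp
  qed (use b in auto)
  then have "b \<in> lasso_argmin X y l" by (auto simp: lasso_argmin_def is_arg_min_linorder)
  then show ?thesis by blast
qed

text \<open>At equal penalty levels the right side vanishes, so all solutions share the fit; at
  different levels it bounds the motion of the fit.\<close>

lemma lasso_kkt_monotone:
  assumes "lasso_kkt X y \<mu> b" "lasso_kkt X y \<mu>' b'"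
  shows "(norm (X *v (b - b')))\<^sup>2 \<le> (\<mu>' - \<mu>) * (l1_norm b - l1_norm b')"
proof -
  have "lasso_corr X y b - lasso_corr X y b' = - (transpose X *v (X *v (b - b')))"
    by (simp add: lasso_corr_def matrix_vector_mult_diff_distrib del: transpose_matrix_vector)
  then have "(norm (X *v (b - b')))\<^sup>2 = - ((lasso_corr X y b - lasso_corr X y b') \<bullet> (b - b'))"
    by (simp only: inner_minus_left transpose_mult_inner power2_norm_eq_inner)
  also have "\<dots> \<le> (\<mu>' - \<mu>) * (l1_norm b - l1_norm b')"
    using lasso_kkt_inner_self[OF assms(1)] lasso_kkt_inner_self[OF assms(2)]
      lasso_kkt_inner_le[OF assms(1), of b'] lasso_kkt_inner_le[OF assms(2), of b]
    unfolding inner_diff_left inner_diff_right left_diff_distrib right_diff_distrib by linarith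
  finally show ?thesis .
qed

text \<open>A bound by the data alone. It makes the right side of \<open>lasso_kkt_monotone\<close>
  tend to 0 as the levels approach each other, before anything is known about the path.\<close>

lemma lasso_kkt_l1_bound:
  assumes "lasso_kkt X y \<mu> b"
  shows "\<mu> * l1_norm b \<le> (norm y)\<^sup>2"
proof -
  have "\<mu> * l1_norm b = y \<bullet> (X *v b) - (X *v b) \<bullet> (X *v b)"
    using lasso_kkt_inner_self[OF assms] by (simp add: lasso_corr_inner inner_diff_left)
  moreover have "0 \<le> (y - X *v b) \<bullet> (y - X *v b)" by simp
  then have "2 * (y \<bullet> (X *v b)) \<le> y \<bullet> y + (X *v b) \<bullet> (X *v b)"
    by (simp add: inner_diff_left inner_diff_right inner_commute)
  ultimately show ?thesis
    using inner_ge_zero[of "X *v b"] inner_ge_zero[of y] unfolding power2_norm_eq_inner by linarith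
qed

section \<open>Injectivity of the design and of the linear system\<close>

lemma invertible_principal_submatrix_injective:
  fixes X :: "real^'p^'n"
  assumes "invertible_principal_submatrix (transpose X ** X) E"
    and supp: "\<And>i. i \<notin> E \<Longrightarrow> w $ i = 0" and "X *v w = 0"
  shows "w = 0"
proof -
  let ?G = "transpose X ** X"
  obtain B :: "real^'p^'p" where B: "\<And>i j. i \<in> E \<Longrightarrow> j \<in> E \<Longrightarrow>
      (\<Sum>k\<in>E. B $ i $ k * ?G $ k $ j) = (if i = j then 1 else 0)"
    using assms(1) unfolding invertible_principal_submatrix_def by blast
  have "?G *v w = 0" by (simp add: \<open>X *v w = 0\<close> flip: matrix_vector_mul_assoc)
  \<comment> \<open>Since \<open>w\<close> is supported in \<open>E\<close>, the full Gram product
    reduces to the block on which \<open>B\<close> is a left inverse.\<close>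
  then have G: "(\<Sum>j\<in>E. ?G $ k $ j * w $ j) = 0" for k
    using supp sum.mono_neutral_left[of UNIV E "\<lambda>j. ?G $ k $ j * w $ j"]
    by (simp add: vec_eq_iff matrix_vector_mult_def)
  have "w $ i = 0" if "i \<in> E" for i
  proof -
    have "w $ i = (\<Sum>j\<in>E. if i = j then w $ j else 0)"
      using that by simp
    also have "\<dots> = (\<Sum>j\<in>E. (\<Sum>k\<in>E. B $ i $ k * ?G $ k $ j) * w $ j)"
      using B that by (intro sum.cong) auto
    also have "\<dots> = (\<Sum>j\<in>E. \<Sum>k\<in>E. B $ i $ k * (?G $ k $ j * w $ j))"
      by (simp add: sum_distrib_right mult.assoc)
    also have "\<dots> = (\<Sum>k\<in>E. \<Sum>j\<in>E. B $ i $ k * (?G $ k $ j * w $ j))"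
      by (rule sum.swap)
    also have "\<dots> = (\<Sum>k\<in>E. B $ i $ k * (\<Sum>j\<in>E. ?G $ k $ j * w $ j))"
      by (simp add: sum_distrib_left)
    finally show ?thesis by (simp add: G)
  qed
  then show ?thesis using supp by (auto simp: vec_eq_iff)
qed

lemma diag_mat_mult_component: "(diag_mat q *v v) $ i = q $ i * v $ i"
  by (simp add: matrix_vector_mult_def diag_mat_def if_distrib[of "\<lambda>c. c * _"] cong: if_cong)

lemma lasso_system_matrix_mult_component:
  "(lasso_system_matrix X q *v w) $ i = w $ i - q $ i * (w $ i - (transpose X *v (X *v w)) $ i)"
  by (simp add: lasso_system_matrix_def matrix_vector_mult_diff_rdistrib diag_mat_mult_component
      flip: matrix_vector_mul_assoc)

text \<open>With \<open>g\<close> the Gram matrix applied to \<open>w\<close>, each row says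
  \<open>(1 - q $ i) * w $ i + q $ i * g $ i = 0\<close>. Hence \<open>w $ i\<close> vanishes or
  does not share the sign of \<open>g $ i\<close>, so \<open>g \<bullet> w \<le> 0\<close>; but this
  inner product is the squared norm of \<open>X *v w\<close>.\<close>

lemma lasso_system_matrix_injective:
  assumes q: "\<And>i. 0 \<le> q $ i \<and> q $ i \<le> 1" "\<And>i. i \<notin> E \<Longrightarrow> q $ i = 0"
    and inj: "\<And>w. (\<And>i. i \<notin> E \<Longrightarrow> w $ i = 0) \<Longrightarrow> X *v w = 0 \<Longrightarrow> w = 0"
    and zero: "lasso_system_matrix X q *v w = 0"
  shows "w = 0"
proof -
  let ?g = "transpose X *v (X *v w)"
  have eq: "(1 - q $ i) * w $ i + q $ i * ?g $ i = 0" for i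
    using lasso_system_matrix_mult_component[of X q w i] zero by (simp add: algebra_simps)
  have q0: "w $ i = 0" if "q $ i = 0" for i using eq[of i] that by simp
  have "?g $ i * w $ i \<le> 0" for i
  proof (cases "q $ i = 0")
    case False
    then have "q $ i > 0" using q(1)[of i] by simp
    have "q $ i * (?g $ i * w $ i) = - ((1 - q $ i) * (w $ i)\<^sup>2)"
      using eq[of i] by (simp add: power2_eq_square algebra_simps) (metis add.commute distrib_left mult.assoc mult.commute mult_zero_right)
    also have "\<dots> \<le> 0" using q(1)[of i] by simp
    finally show ?thesis using \<open>q $ i > 0\<close> by (simp add: mult_le_0_iff)
  qed (simp add: q0)
  then have "?g \<bullet> w \<le> 0" by (simp add: inner_vec_def sum_nonpos)
  then have "X *v w = 0" unfolding transpose_mult_inner by (simp flip: power2_norm_eq_inner)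
  then show ?thesis using q0 q(2) by (intro inj) auto
qed

lemma lasso_equicorrelation_iff:
  "i \<in> equicorrelation_set X y l b \<longleftrightarrow> \<bar>lasso_corr X y b $ i\<bar> = exp l"
  by (simp add: equicorrelation_set_def lasso_corr_component)

lemma lasso_kkt_supp_subset:
  "lasso_kkt X y (exp l) b \<Longrightarrow> i \<notin> equicorrelation_set X y l b \<Longrightarrow> b $ i = 0"
  unfolding lasso_kkt_def lasso_equicorrelation_iff
  by (metis abs_exp_cancel abs_mult abs_sgn_eq mult.right_neutral)

lemma l1_norm_diff_le: "\<bar>l1_norm b - l1_norm b'\<bar> \<le> real CARD('p) * norm (b - b')"
  for b b' :: "real^'p"
proof -
  have "\<bar>l1_norm b - l1_norm b'\<bar> \<le> (\<Sum>i\<in>UNIV. \<bar>\<bar>b $ i\<bar> - \<bar>b' $ i\<bar>\<bar>)"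
    unfolding sum_subtractf[symmetric] by (rule sum_abs)
  also have "\<dots> \<le> (\<Sum>i\<in>(UNIV :: 'p set). norm (b - b'))"
  proof (rule sum_mono)
    fix i
    have "\<bar>\<bar>b $ i\<bar> - \<bar>b' $ i\<bar>\<bar> \<le> \<bar>(b - b') $ i\<bar>" by simp
    also have "\<dots> \<le> norm (b - b')" by (rule component_le_norm_cart)
    finally show "\<bar>\<bar>b $ i\<bar> - \<bar>b' $ i\<bar>\<bar> \<le> norm (b - b')" .
  qed
  finally show ?thesis by simp
qed

section \<open>The solution path\<close>

text \<open>\<open>bhat\<close> is any selection of solutions; that there is only one is derived.
  The rank hypothesis enters as injectivity of \<open>X\<close> on vectors supported in the
  equicorrelation set.\<close>

locale lasso_path =
  fixes X :: "real^'p^'n" and y :: "real^'n" and bhat :: "real \<Rightarrow> real^'p"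
  assumes kkt: "lasso_kkt X y (exp l) (bhat l)"
    and injective: "(\<And>i. i \<notin> equicorrelation_set X y l (bhat l) \<Longrightarrow> w $ i = 0) \<Longrightarrow> X *v w = 0 \<Longrightarrow> w = 0"
begin

abbreviation "eqc l \<equiv> equicorrelation_set X y l (bhat l)"

abbreviation "corr l \<equiv> lasso_corr X y (bhat l)"

text \<open>Equal fits give equal equicorrelation sets, so the difference of two solutions is
  supported where \<open>X\<close> is injective.\<close>

lemma unique:
  assumes "lasso_kkt X y (exp l) b"
  shows "b = bhat l"
proof -
  have "X *v (b - bhat l) = 0"
    using lasso_kkt_monotone[OF assms kkt[of l]] by simp
  then have X: "X *v b = X *v bhat l" by (simp add: matrix_vector_mult_diff_distrib)
  have "b - bhat l = 0"
  proof (rule injective)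
    show "X *v (b - bhat l) = 0" by fact
    fix i assume i: "i \<notin> eqc l"
    then have "i \<notin> equicorrelation_set X y l b" by (simp add: equicorrelation_set_def X)
    then show "(b - bhat l) $ i = 0"
      using lasso_kkt_supp_subset[OF kkt i] lasso_kkt_supp_subset[OF assms] by simp
  qed
  then show ?thesis by simp
qed

lemma corr_tendsto: "((\<lambda>l'. corr l') \<longlongrightarrow> corr l) (at l)"
proof -
  let ?F = "\<lambda>l'. \<bar>exp l - exp l'\<bar> * ((norm y)\<^sup>2 / exp l' + (norm y)\<^sup>2 / exp l)"
  have bound: "(norm (X *v (bhat l' - bhat l)))\<^sup>2 \<le> ?F l'" for l'
  proof -
    have l1: "l1_norm (bhat k) \<le> (norm y)\<^sup>2 / exp k" for k
      using lasso_kkt_l1_bound[OF kkt[of k]] by (simp add: field_simps)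
    have "(norm (X *v (bhat l' - bhat l)))\<^sup>2 \<le> (exp l - exp l') * (l1_norm (bhat l') - l1_norm (bhat l))"
      by (rule lasso_kkt_monotone[OF kkt kkt])
    also have "\<dots> \<le> \<bar>exp l - exp l'\<bar> * \<bar>l1_norm (bhat l') - l1_norm (bhat l)\<bar>"
      by (metis abs_ge_self abs_mult)
    also have "\<dots> \<le> ?F l'"
    proof (rule mult_left_mono)
      have "0 \<le> l1_norm (bhat k)" for k by (simp add: sum_nonneg)
      from this[of l] this[of l'] l1[of l] l1[of l']
      show "\<bar>l1_norm (bhat l') - l1_norm (bhat l)\<bar> \<le> (norm y)\<^sup>2 / exp l' + (norm y)\<^sup>2 / exp l"
        by linarith
    qed simp
    finally show ?thesis .
  qed
  have "(?F \<longlongrightarrow> \<bar>exp l - exp l\<bar> * ((norm y)\<^sup>2 / exp l + (norm y)\<^sup>2 / exp l)) (at l)"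
    by (intro tendsto_intros) auto
  then have "(?F \<longlongrightarrow> 0) (at l)" by simp
  then have "((\<lambda>l'. (norm (X *v (bhat l' - bhat l)))\<^sup>2) \<longlongrightarrow> 0) (at l)"
    by (rule Lim_null_comparison[rotated]) (auto intro!: always_eventually bound)
  then have "((\<lambda>l'. sqrt ((norm (X *v (bhat l' - bhat l)))\<^sup>2)) \<longlongrightarrow> sqrt 0) (at l)"
    by (rule tendsto_real_sqrt)
  then have "((\<lambda>l'. X *v (bhat l' - bhat l)) \<longlongrightarrow> 0) (at l)"
    by (simp add: tendsto_norm_zero_iff)
  then have "((\<lambda>l'. X *v bhat l') \<longlongrightarrow> X *v bhat l) (at l)"
    unfolding matrix_vector_mult_diff_distrib by (subst (asm) LIM_zero_iff)
  then show ?thesis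
    unfolding lasso_corr_def
    by (intro bounded_linear.tendsto[OF matrix_vector_mul_bounded_linear tendsto_diff[OF tendsto_const]])
qed

lemma corr_component_isCont: "isCont (\<lambda>l. corr l $ i) l"
  unfolding isCont_def by (intro tendsto_vec_nth corr_tendsto)

lemma eventually_not_eqc:
  assumes "i \<notin> eqc l"
  shows "eventually (\<lambda>l'. i \<notin> eqc l') (nhds l)"
proof -
  let ?f = "\<lambda>l'. exp l' - \<bar>corr l' $ i\<bar>"
  have "0 < ?f l"
    using assms kkt[of l] by (auto simp: lasso_equicorrelation_iff lasso_kkt_def less_le)
  moreover have "isCont ?f l" by (intro continuous_intros corr_component_isCont)
  then have "(?f \<longlongrightarrow> ?f l) (nhds l)"
    unfolding isCont_def using tendsto_at_iff_tendsto_nhds[of ?f l] by blast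
  ultimately have "eventually (\<lambda>l'. 0 < ?f l') (nhds l)"
    by (rule order_tendstoD(1)[rotated])
  then show ?thesis
    by (rule eventually_mono) (auto simp: lasso_equicorrelation_iff)
qed

lemma eqc_subset_nearby: "\<exists>e>0. \<forall>l'\<in>ball l e. eqc l' \<subseteq> eqc l"
proof -
  have "eventually (\<lambda>l'. \<forall>i\<in>- eqc l. i \<notin> eqc l') (nhds l)"
    by (intro eventually_ball_finite) (auto intro: eventually_not_eqc)
  then show ?thesis
    unfolding eventually_nhds_metric by (force simp: dist_commute)
qed

text \<open>All solutions near \<open>l\<close> lie in the one subspace of vectors supported in
  \<open>eqc l\<close>, where \<open>X\<close> is bounded below by \<open>\<kappa>\<close>.
  Monotonicity then bounds the square of the distance by a term linear in the distance, and one
  factor cancels.\<close>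

lemma lipschitz_nearby: "\<exists>e>0. \<exists>L. L-lipschitz_on (ball l e) bhat"
proof -
  obtain e where e: "e > 0" "\<And>l'. l' \<in> ball l e \<Longrightarrow> eqc l' \<subseteq> eqc l"
    using eqc_subset_nearby[of l] by blast
  let ?S = "{w. \<forall>i. i \<notin> eqc l \<longrightarrow> w $ i = 0} :: (real^'p) set"
  have "subspace ?S" by (auto simp: subspace_def)
  then obtain \<kappa> where \<kappa>: "\<kappa> > 0" "\<And>w. w \<in> ?S \<Longrightarrow> \<kappa> * norm w \<le> norm (X *v w)"
    using injective_imp_isometric[OF closed_subspace _ matrix_vector_mul_bounded_linear, of ?S X] injective[of l]
    by (auto simp: mult.commute)
  let ?p = "real CARD('p)"
  \<comment> \<open>Radius at most 1 makes \<open>exp (l + 1)\<close> a Lipschitz constant of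
    \<open>exp\<close> on the ball.\<close>
  define e' where "e' = min e 1"
  have "dist (bhat l1) (bhat l2) \<le> (?p / \<kappa>\<^sup>2 * exp (l + 1)) * dist l1 l2"
    if l12: "l1 \<in> ball l e'" "l2 \<in> ball l e'" for l1 l2
  proof (cases "bhat l1 = bhat l2")
    case False
    let ?d = "norm (bhat l1 - bhat l2)"
    have "?d > 0" using False by simp
    have "bhat l' $ i = 0" if "l' \<in> ball l e'" "i \<notin> eqc l" for l' i
      using lasso_kkt_supp_subset[OF kkt, of i l'] e(2)[of l'] that by (auto simp: e'_def)
    then have "bhat l1 - bhat l2 \<in> ?S" using l12 by simp
    then have "(\<kappa> * ?d)\<^sup>2 \<le> (norm (X *v (bhat l1 - bhat l2)))\<^sup>2"
      using \<kappa> by (intro power_mono) auto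
    also have "\<dots> \<le> (exp l2 - exp l1) * (l1_norm (bhat l1) - l1_norm (bhat l2))"
      by (rule lasso_kkt_monotone[OF kkt kkt])
    also have "\<dots> \<le> \<bar>exp l2 - exp l1\<bar> * \<bar>l1_norm (bhat l1) - l1_norm (bhat l2)\<bar>"
      by (metis abs_ge_self abs_mult)
    also have "\<dots> \<le> \<bar>exp l2 - exp l1\<bar> * (?p * ?d)"
      by (intro mult_left_mono l1_norm_diff_le) auto
    finally have "?d * (\<kappa>\<^sup>2 * ?d) \<le> ?d * (\<bar>exp l2 - exp l1\<bar> * ?p)"
      by (simp add: power_mult_distrib power2_eq_square mult_ac)
    then have "\<kappa>\<^sup>2 * ?d \<le> \<bar>exp l2 - exp l1\<bar> * ?p"
      using \<open>?d > 0\<close> by (simp only: mult_le_cancel_left_pos)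
    also have "\<dots> \<le> exp (l + 1) * \<bar>l2 - l1\<bar> * ?p"
    proof (rule mult_right_mono)
      have "norm (exp l2 - exp l1) \<le> exp (l + 1) * norm (l2 - l1)"
      proof (rule field_differentiable_bound[where f = exp and f' = exp and S = "{..l + 1}"])
        show "(exp has_field_derivative exp z) (at z within {..l + 1})" for z :: real
          by (auto intro!: derivative_eq_intros)
      qed (use l12 in \<open>auto simp: e'_def dist_real_def\<close>)
      then show "\<bar>exp l2 - exp l1\<bar> \<le> exp (l + 1) * \<bar>l2 - l1\<bar>" by simp
    qed simp
    finally show ?thesis
      using \<kappa>(1) by (simp add: dist_norm field_simps abs_minus_commute)
  qed auto
  then have "(?p / \<kappa>\<^sup>2 * exp (l + 1))-lipschitz_on (ball l e') bhat"
    by (intro lipschitz_onI) auto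
  moreover have "e' > 0" using e(1) by (simp add: e'_def)
  ultimately show ?thesis by blast
qed

lemma bhat_isCont: "isCont bhat l"
proof -
  obtain e L where "e > 0" "L-lipschitz_on (ball l e) bhat" using lipschitz_nearby by blast
  then show ?thesis
    using lipschitz_on_continuous_on[of L "ball l e" bhat] by (simp add: continuous_on_eq_continuous_at)
qed

end

section \<open>Affine pieces of the path and their breakpoints\<close>

lemma finite_no_three_increasing:
  fixes F :: "'a::linorder set"
  assumes "\<And>x y z. x \<in> F \<Longrightarrow> y \<in> F \<Longrightarrow> z \<in> F \<Longrightarrow> x < y \<Longrightarrow> y < z \<Longrightarrow> False"
  shows "finite F"
proof (cases "\<exists>x y. x \<in> F \<and> y \<in> F \<and> x < y")
  case True
  then obtain x y where "x \<in> F" "y \<in> F" "x < y" by blast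
  then have "F \<subseteq> {x, y}"
    using assms by (metis insert_iff linorder_less_linear subsetI)
  then show ?thesis by (rule finite_subset) simp
next
  case False
  then have "F \<subseteq> {x}" if "x \<in> F" for x
    using that by (metis insert_iff linorder_less_linear subsetI)
  then show ?thesis
    by (metis all_not_in_conv finite.simps finite_subset)
qed

lemma exp_convex_combination:
  fixes l1 l l2 :: real
  assumes "l1 < l" "l < l2"
  shows "\<exists>\<theta>. 0 < \<theta> \<and> \<theta> < 1 \<and> exp l = (1 - \<theta>) * exp l1 + \<theta> * exp l2 \<and>
    \<theta> = (exp l - exp l1) / (exp l2 - exp l1)"
proof -
  define \<theta> where "\<theta> = (exp l - exp l1) / (exp l2 - exp l1)"
  have lt: "exp l1 < exp l" "exp l < exp l2" using assms by auto
  then have "0 < \<theta>" "\<theta> < 1" "\<theta> * (exp l2 - exp l1) = exp l - exp l1"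
    by (auto simp: \<theta>_def)
  moreover from this(3) have "exp l = (1 - \<theta>) * exp l1 + \<theta> * exp l2"
    by (simp only: algebra_simps)
  ultimately show ?thesis
    using \<theta>_def by blast
qed

lemma lasso_corr_convex_combination:
  "lasso_corr X y ((1 - \<theta>) *\<^sub>R b1 + \<theta> *\<^sub>R b2) = (1 - \<theta>) *\<^sub>R lasso_corr X y b1 + \<theta> *\<^sub>R lasso_corr X y b2"
proof -
  have "y - X *v ((1 - \<theta>) *\<^sub>R b1 + \<theta> *\<^sub>R b2) = (1 - \<theta>) *\<^sub>R (y - X *v b1) + \<theta> *\<^sub>R (y - X *v b2)"
    by (simp add: matrix_vector_right_distrib matrix_vector_mult_scaleR algebra_simps)
  then show ?thesis
    unfolding lasso_corr_def by (simp only: matrix_vector_right_distrib matrix_vector_mult_scaleR)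
qed

lemma lasso_corr_diff: "lasso_corr X y b - lasso_corr X y b' = transpose X *v (X *v (b' - b))"
  by (simp add: lasso_corr_def matrix_vector_mult_diff_distrib del: transpose_matrix_vector)

lemma matrix_inv:
  fixes A :: "real^'n^'n"
  assumes "invertible A"
  shows "A ** matrix_inv A = mat 1" "matrix_inv A ** A = mat 1"
  using someI_ex[OF assms[unfolded invertible_def]] unfolding matrix_inv_def by auto

context lasso_path
begin

text \<open>The value type is finite. The signs of the coefficients allow solutions to be mixed; the
  active bounds let the sign of a correlation at one end of an interval be read off at the
  other.\<close>

definition sign_pattern :: "real \<Rightarrow> 'p set \<times> 'p set \<times> 'p set \<times> 'p set" where
  "sign_pattern l = ({i. bhat l $ i > 0}, {i. bhat l $ i < 0}, {i. corr l $ i = exp l}, {i. corr l $ i = - exp l})"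

text \<open>KKT points with a common sign pattern form a convex set, so the solution is affine in
  \<open>exp l\<close> between two parameters with the same pattern.\<close>

lemma bhat_affine:
  assumes "sign_pattern l1 = sign_pattern l2" "l1 < l" "l < l2"
    and \<theta>: "\<theta> = (exp l - exp l1) / (exp l2 - exp l1)"
  shows "bhat l = (1 - \<theta>) *\<^sub>R bhat l1 + \<theta> *\<^sub>R bhat l2"
proof (rule unique[symmetric])
  have t: "0 < \<theta>" "\<theta> < 1" "exp l = (1 - \<theta>) * exp l1 + \<theta> * exp l2"
    using exp_convex_combination[OF assms(2,3)] \<theta> by auto
  have b: "0 < bhat l1 $ i \<longleftrightarrow> 0 < bhat l2 $ i" "bhat l1 $ i < 0 \<longleftrightarrow> bhat l2 $ i < 0" for i
    using assms(1) by (auto simp: sign_pattern_def set_eq_iff)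
  let ?b = "(1 - \<theta>) *\<^sub>R bhat l1 + \<theta> *\<^sub>R bhat l2"
  show "lasso_kkt X y (exp l) ?b"
    unfolding lasso_kkt_def lasso_corr_convex_combination
  proof (intro allI conjI impI)
    fix i
    let ?c = "((1 - \<theta>) *\<^sub>R corr l1 + \<theta> *\<^sub>R corr l2) $ i"
    have "\<bar>?c\<bar> \<le> (1 - \<theta>) * \<bar>corr l1 $ i\<bar> + \<theta> * \<bar>corr l2 $ i\<bar>"
      using t(1,2) abs_triangle_ineq[of "(1 - \<theta>) * corr l1 $ i" "\<theta> * corr l2 $ i"] by (simp add: abs_mult)
    also have "\<dots> \<le> exp l"
      unfolding t(3) using kkt[of l1] kkt[of l2] t(1,2)
      by (intro add_mono mult_left_mono) (auto simp: lasso_kkt_def)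
    finally show "\<bar>?c\<bar> \<le> exp l" .
    assume nz: "?b $ i \<noteq> 0"
    have "bhat l1 $ i > 0 \<and> bhat l2 $ i > 0 \<or> bhat l1 $ i < 0 \<and> bhat l2 $ i < 0"
      using nz b[of i] by (cases "bhat l1 $ i" "0::real" rule: linorder_cases;
          cases "bhat l2 $ i" "0::real" rule: linorder_cases) auto
    then show "?c = exp l * sgn (?b $ i)"
    proof
      assume pos: "bhat l1 $ i > 0 \<and> bhat l2 $ i > 0"
      then have "corr l1 $ i = exp l1" "corr l2 $ i = exp l2"
        using kkt[of l1] kkt[of l2] by (auto simp: lasso_kkt_def)
      moreover have "?b $ i > 0" using pos t(1,2) by (simp add: add_pos_pos)
      ultimately show ?thesis using t(3) by simp
    next
      assume neg: "bhat l1 $ i < 0 \<and> bhat l2 $ i < 0"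
      then have "corr l1 $ i = - exp l1" "corr l2 $ i = - exp l2"
        using kkt[of l1] kkt[of l2] by (auto simp: lasso_kkt_def)
      moreover have "?b $ i < 0"
        using neg t(1,2) by (simp add: add_neg_neg mult_pos_neg)
      ultimately show ?thesis using t(3) by simp
    qed
  qed
qed

text \<open>The test is recurrence of a pattern on both sides, not smoothness: every other parameter
  lies strictly inside an interval where \<open>bhat_affine\<close> applies, and finiteness becomes
  a matter of counting.\<close>

definition breakpoints :: "real set" where
  "breakpoints = {l. \<nexists>l1 l2. l1 < l \<and> l < l2 \<and> sign_pattern l1 = sign_pattern l2}"

text \<open>Of three breakpoints with the same pattern the middle one would be no breakpoint, so
  each pattern accounts for at most two.\<close>

lemma finite_breakpoints: "finite breakpoints"
proof -
  have "finite (breakpoints \<inter> sign_pattern -` {P})" for P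
  proof (rule finite_no_three_increasing)
    fix l1 l l2
    assume "l1 \<in> breakpoints \<inter> sign_pattern -` {P}" "l \<in> breakpoints \<inter> sign_pattern -` {P}"
      "l2 \<in> breakpoints \<inter> sign_pattern -` {P}" "l1 < l" "l < l2"
    then have "l \<in> breakpoints" "sign_pattern l1 = sign_pattern l2" by auto
    then show False
      unfolding breakpoints_def using \<open>l1 < l\<close> \<open>l < l2\<close> by blast
  qed
  then have "finite (\<Union>P. breakpoints \<inter> sign_pattern -` {P})"
    by (intro finite_UN_I finite)
  moreover have "(\<Union>P. breakpoints \<inter> sign_pattern -` {P}) = breakpoints" by auto
  ultimately show ?thesis by simp
qed

lemma multiplier_bounds:
  assumes "q \<in> lasso_multipliers X y l (bhat l)"
  shows "0 \<le> q $ i \<and> q $ i \<le> 1"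
  using assms by (cases "i \<in> supp_vec (bhat l)"; cases "i \<in> eqc l") (auto simp: lasso_multipliers_def)

lemma system_matrix_injective:
  assumes "\<And>i. 0 \<le> q $ i \<and> q $ i \<le> 1" "\<And>i. i \<notin> eqc l \<Longrightarrow> q $ i = 0"
    and "lasso_system_matrix X q *v w = 0"
  shows "w = 0"
  by (rule lasso_system_matrix_injective[of q "eqc l" X, OF assms(1,2) injective assms(3)])

lemma system_matrix_invertible:
  assumes "q \<in> lasso_multipliers X y l (bhat l)"
  shows "invertible (lasso_system_matrix X q)"
  unfolding invertible_left_inverse matrix_left_invertible_ker
  using system_matrix_injective[OF multiplier_bounds[OF assms]] assms
  by (auto simp: lasso_multipliers_def)

text \<open>The argument of the sign is \<open>bhat l + corr l\<close>, the point whose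
  soft-thresholding at level \<open>exp l\<close> is \<open>bhat l\<close>.\<close>

definition rhs :: "real \<Rightarrow> real^'p \<Rightarrow> real^'p" where
  "rhs l q = diag_mat q *v sign_vec (bhat l - transpose X *v (X *v bhat l - y))"

lemma rhs_component: "rhs l q $ i = q $ i * sgn (bhat l $ i + corr l $ i)"
proof -
  have eq: "bhat l - transpose X *v (X *v bhat l - y) = bhat l + corr l"
    by (simp add: lasso_corr_def matrix_vector_mult_diff_distrib del: transpose_matrix_vector)
  show ?thesis
    unfolding rhs_def eq diag_mat_mult_component sign_vec_def by simp
qed

text \<open>A nonzero coefficient has the sign of its correlation, so the two cannot cancel. That
  the sum is nonzero makes the sign continuous there, as the closed graph requires.\<close>

lemma sgn_on_eqc:
  assumes "i \<in> eqc l"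
  shows "sgn (bhat l $ i + corr l $ i) = sgn (corr l $ i)" "bhat l $ i + corr l $ i \<noteq> 0"
proof -
  have a: "\<bar>corr l $ i\<bar> = exp l" using assms by (simp add: lasso_equicorrelation_iff)
  then have c: "corr l $ i = exp l \<or> corr l $ i = - exp l" by linarith
  have "bhat l $ i > 0 \<Longrightarrow> corr l $ i = exp l" "bhat l $ i < 0 \<Longrightarrow> corr l $ i = - exp l"
    using kkt[of l] by (auto simp: lasso_kkt_def)
  then have "corr l $ i = exp l \<and> bhat l $ i \<ge> 0 \<or> corr l $ i = - exp l \<and> bhat l $ i \<le> 0"
    using c by (metis exp_gt_zero less_eq_real_def linorder_not_less neg_0_less_iff_less order_less_asym)
  then show "sgn (bhat l $ i + corr l $ i) = sgn (corr l $ i)" "bhat l $ i + corr l $ i \<noteq> 0"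
    using exp_gt_zero[of l] by (elim disjE; simp add: sgn_if; linarith)+
qed

text \<open>Trades the matrix inverse for a linear equation, which passes to limits and whose
  solutions can be compared directly.\<close>

lemma mem_jacobian_iff:
  "M \<in> lasso_jacobian X y l (bhat l) \<longleftrightarrow>
    (\<exists>q w. q \<in> lasso_multipliers X y l (bhat l) \<and> lasso_system_matrix X q *v w = rhs l q \<and>
      M = columnvector (- exp l *\<^sub>R w))"
proof
  assume "M \<in> lasso_jacobian X y l (bhat l)"
  then obtain q where q: "q \<in> lasso_multipliers X y l (bhat l)"
    "M = columnvector (- exp l *\<^sub>R (matrix_inv (lasso_system_matrix X q) *v rhs l q))"
    unfolding lasso_jacobian_def rhs_def by blast
  have "lasso_system_matrix X q *v (matrix_inv (lasso_system_matrix X q) *v rhs l q) = rhs l q"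
    using matrix_inv(1)[OF system_matrix_invertible[OF q(1)]] by (simp add: matrix_vector_mul_assoc)
  then show "\<exists>q w. q \<in> lasso_multipliers X y l (bhat l) \<and> lasso_system_matrix X q *v w = rhs l q \<and>
      M = columnvector (- exp l *\<^sub>R w)"
    using q by blast
next
  assume "\<exists>q w. q \<in> lasso_multipliers X y l (bhat l) \<and> lasso_system_matrix X q *v w = rhs l q \<and>
      M = columnvector (- exp l *\<^sub>R w)"
  then obtain q w where q: "q \<in> lasso_multipliers X y l (bhat l)"
    "lasso_system_matrix X q *v w = rhs l q" "M = columnvector (- exp l *\<^sub>R w)" by blast
  have "matrix_inv (lasso_system_matrix X q) *v rhs l q = w"
    using matrix_inv(2)[OF system_matrix_invertible[OF q(1)]]
    by (simp add: q(2)[symmetric] matrix_vector_mul_assoc)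
  then show "M \<in> lasso_jacobian X y l (bhat l)"
    using q(1,3) unfolding lasso_jacobian_def rhs_def[symmetric] by blast
qed

lemma derivative_off_breakpoints:
  assumes "l \<notin> breakpoints"
  shows "\<exists>d. (bhat has_vector_derivative - exp l *\<^sub>R d) (at l) \<and>
    (\<forall>q\<in>lasso_multipliers X y l (bhat l). lasso_system_matrix X q *v d = rhs l q)"
proof -
  obtain l1 l2 where l12: "sign_pattern l1 = sign_pattern l2" "l1 < l" "l < l2"
    using assms by (auto simp: breakpoints_def)
  define \<Delta> where "\<Delta> = exp l2 - exp l1"
  have "\<Delta> > 0" using l12 by (simp add: \<Delta>_def)
  \<comment> \<open>Minus the slope of the path in \<open>exp l\<close>.\<close>
  define d where "d = (1 / \<Delta>) *\<^sub>R (bhat l1 - bhat l2)"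
  have affine: "bhat l' = bhat l1 - (exp l' - exp l1) *\<^sub>R d" if "l' \<in> {l1<..<l2}" for l'
    using bhat_affine[OF l12(1), of l' "(exp l' - exp l1) / \<Delta>"] that
    by (simp add: d_def \<Delta>_def algebra_simps)
  have "((\<lambda>l'. bhat l1 - (exp l' - exp l1) *\<^sub>R d) has_vector_derivative - exp l *\<^sub>R d) (at l)"
    by (auto intro!: derivative_eq_intros)
  then have deriv: "(bhat has_vector_derivative - exp l *\<^sub>R d) (at l)"
    by (rule has_vector_derivative_transform_within_open[where S = "{l1<..<l2}"]) (use l12 affine in auto)
  obtain \<theta> where t: "0 < \<theta>" "\<theta> < 1" "exp l = (1 - \<theta>) * exp l1 + \<theta> * exp l2"
    and t': "\<theta> = (exp l - exp l1) / (exp l2 - exp l1)"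
    using exp_convex_combination[OF l12(2,3)] by blast
  have bl: "bhat l = (1 - \<theta>) *\<^sub>R bhat l1 + \<theta> *\<^sub>R bhat l2"
    by (rule bhat_affine[OF l12 t'])
  have cl: "corr l = (1 - \<theta>) *\<^sub>R corr l1 + \<theta> *\<^sub>R corr l2"
    unfolding bl lasso_corr_convex_combination ..
  have Gd: "transpose X *v (X *v d) = (1 / \<Delta>) *\<^sub>R (corr l2 - corr l1)"
    unfolding lasso_corr_diff d_def by (simp only: matrix_vector_mult_scaleR)
  \<comment> \<open>A positive combination of two numbers of the same sign vanishes only if both do,
    so coefficient \<open>i\<close> is zero at both ends.\<close>
  have d0: "d $ i = 0" if "i \<notin> supp_vec (bhat l)" for i
  proof -
    have b: "0 < bhat l1 $ i \<longleftrightarrow> 0 < bhat l2 $ i" "bhat l1 $ i < 0 \<longleftrightarrow> bhat l2 $ i < 0"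
      using l12(1) by (auto simp: sign_pattern_def set_eq_iff)
    have z: "(1 - \<theta>) * bhat l1 $ i + \<theta> * bhat l2 $ i = 0"
      using that bl by (simp add: supp_vec_def)
    have "\<not> 0 < bhat l1 $ i"
    proof
      assume "0 < bhat l1 $ i"
      then have "0 < (1 - \<theta>) * bhat l1 $ i + \<theta> * bhat l2 $ i"
        using b t by (intro add_pos_pos mult_pos_pos) auto
      then show False using z by simp
    qed
    moreover have "\<not> bhat l1 $ i < 0"
    proof
      assume "bhat l1 $ i < 0"
      then have "(1 - \<theta>) * bhat l1 $ i + \<theta> * bhat l2 $ i < 0"
        using b t by (intro add_neg_neg mult_pos_neg) auto
      then show False using z by simp
    qed
    ultimately show ?thesis using b by (simp add: d_def)
  qed
  \<comment> \<open>An active bound at the interior point \<open>l\<close> forces equality in the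
    triangle inequality, hence an active bound at \<open>l1\<close>; the common pattern gives the
    same signed bound at \<open>l2\<close>.\<close>
  have Gd1: "(transpose X *v (X *v d)) $ i = sgn (corr l $ i)" if i: "i \<in> eqc l" for i
  proof -
    have c: "corr l1 $ i = exp l1 \<longleftrightarrow> corr l2 $ i = exp l2" "corr l1 $ i = - exp l1 \<longleftrightarrow> corr l2 $ i = - exp l2"
      using l12(1) by (auto simp: sign_pattern_def set_eq_iff)
    have le: "\<bar>corr l1 $ i\<bar> \<le> exp l1" "\<bar>corr l2 $ i\<bar> \<le> exp l2"
      using kkt[of l1] kkt[of l2] by (auto simp: lasso_kkt_def)
    have "\<bar>(1 - \<theta>) * corr l1 $ i + \<theta> * corr l2 $ i\<bar> = (1 - \<theta>) * exp l1 + \<theta> * exp l2"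
      using i unfolding lasso_equicorrelation_iff t(3) cl by simp
    moreover have "\<bar>(1 - \<theta>) * corr l1 $ i + \<theta> * corr l2 $ i\<bar> \<le> (1 - \<theta>) * \<bar>corr l1 $ i\<bar> + \<theta> * \<bar>corr l2 $ i\<bar>"
      using t(1,2) abs_triangle_ineq[of "(1 - \<theta>) * corr l1 $ i" "\<theta> * corr l2 $ i"] by (simp add: abs_mult)
    moreover have "\<theta> * \<bar>corr l2 $ i\<bar> \<le> \<theta> * exp l2" using le t by simp
    ultimately have "(1 - \<theta>) * exp l1 \<le> (1 - \<theta>) * \<bar>corr l1 $ i\<bar>" by linarith
    then have "\<bar>corr l1 $ i\<bar> = exp l1" using le t by simp
    then have "corr l1 $ i = exp l1 \<or> corr l1 $ i = - exp l1" by linarith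
    then show ?thesis
    proof
      assume p: "corr l1 $ i = exp l1"
      have "corr l $ i = exp l" unfolding cl t(3) using p c by simp
      then show ?thesis unfolding Gd using p c \<open>\<Delta> > 0\<close> by (simp add: \<Delta>_def)
    next
      assume p: "corr l1 $ i = - exp l1"
      have "corr l $ i = - exp l" unfolding cl t(3) using p c by simp
      then show ?thesis unfolding Gd using p c \<open>\<Delta> > 0\<close> by (simp add: \<Delta>_def divide_simps)
    qed
  qed
  have "lasso_system_matrix X q *v d = rhs l q" if q: "q \<in> lasso_multipliers X y l (bhat l)" for q
    unfolding vec_eq_iff lasso_system_matrix_mult_component rhs_component
  proof
    fix i
    consider "i \<in> supp_vec (bhat l)" "i \<in> eqc l" | "i \<notin> supp_vec (bhat l)" "i \<in> eqc l" | "i \<notin> eqc l"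
      by blast
    then show "d $ i - q $ i * (d $ i - (transpose X *v (X *v d)) $ i) = q $ i * sgn (bhat l $ i + corr l $ i)"
    proof cases
      case 1
      then have "q $ i = 1" using q by (simp add: lasso_multipliers_def)
      then show ?thesis using Gd1[OF 1(2)] sgn_on_eqc(1)[OF 1(2)] by simp
    next
      case 2
      then show ?thesis using d0 Gd1[OF 2(2)] sgn_on_eqc(1)[OF 2(2)] by simp
    next
      case 3
      then have "q $ i = 0" "i \<notin> supp_vec (bhat l)"
        using q lasso_kkt_supp_subset[OF kkt 3] by (auto simp: lasso_multipliers_def supp_vec_def)
      then show ?thesis using d0 by simp
    qed
  qed
  then show ?thesis using deriv by blast
qed

end

section \<open>Chain rule at level crossings and at zero speed\<close>

lemma countable_isolated:
  fixes Z :: "'a::second_countable_topology set"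
  assumes "\<And>t. t \<in> Z \<Longrightarrow> eventually (\<lambda>z. z \<notin> Z) (at t)"
  shows "countable Z"
proof -
  have "\<exists>U. open U \<and> t \<in> U \<and> U \<inter> Z = {t}" if "t \<in> Z" for t
    using assms[OF that] that unfolding eventually_at_topological by blast
  then obtain U where U: "\<And>t. t \<in> Z \<Longrightarrow> open (U t) \<and> t \<in> U t \<and> U t \<inter> Z = {t}" by metis
  \<comment> \<open>Each neighbourhood holds exactly one point of \<open>Z\<close>, so a countable
    subcover enumerates \<open>Z\<close>.\<close>
  obtain \<F> where F: "\<F> \<subseteq> U ` Z" "countable \<F>" "\<Union>\<F> = \<Union>(U ` Z)"
    using Lindelof[of "U ` Z"] U by blast
  have "Z \<subseteq> (\<lambda>V. THE t. V \<inter> Z = {t}) ` \<F>"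
  proof
    fix t assume "t \<in> Z"
    then obtain V where V: "V \<in> \<F>" "t \<in> V" using U F(3) by blast
    then obtain s where "s \<in> Z" "V = U s" using F(1) by blast
    then have "V \<inter> Z = {t}" using U[of s] V \<open>t \<in> Z\<close> by (metis IntI singletonD)
    then show "t \<in> (\<lambda>V. THE t. V \<inter> Z = {t}) ` \<F>"
      using V(1) by (intro image_eqI[of _ _ V]) auto
  qed
  then show ?thesis using F(2) by (meson countable_image countable_subset)
qed

lemma countable_level_nonzero_derivative:
  fixes f :: "real \<Rightarrow> real"
  shows "countable {t. f t = c \<and> (\<exists>v. v \<noteq> 0 \<and> (f has_real_derivative v) (at t))}"
proof (rule countable_isolated)
  fix t assume "t \<in> {t. f t = c \<and> (\<exists>v. v \<noteq> 0 \<and> (f has_real_derivative v) (at t))}"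
  then obtain v where v: "f t = c" "v \<noteq> 0" "(f has_real_derivative v) (at t)" by blast
  then have "((\<lambda>z. (f z - f t) / (z - t)) \<longlongrightarrow> v) (at t)"
    by (simp add: has_field_derivative_iff)
  then have "eventually (\<lambda>z. (f z - f t) / (z - t) \<noteq> 0) (at t)"
    using v(2) by (rule tendsto_imp_eventually_ne)
  then show "eventually (\<lambda>z. z \<notin> {t. f t = c \<and> (\<exists>v. v \<noteq> 0 \<and> (f has_real_derivative v) (at t))}) (at t)"
    by (rule eventually_mono) (use v(1) in auto)
qed

text \<open>Handles breakpoints met at zero speed, where \<open>h\<close> need not be
  differentiable: the Lipschitz bound carries the little-o estimate of \<open>f\<close> over to the
  composition.\<close>

lemma lipschitz_compose_zero_derivative:
  fixes h :: "real \<Rightarrow> 'b::real_normed_vector"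
  assumes lip: "L-lipschitz_on (ball (f t) e) h" and "e > 0"
    and f: "(f has_real_derivative 0) (at t)"
  shows "((\<lambda>s. h (f s)) has_vector_derivative 0) (at t)"
  unfolding has_vector_derivative_def has_derivative_within_alt
proof (intro conjI allI impI)
  show "bounded_linear (\<lambda>x::real. x *\<^sub>R (0::'b))" by (simp add: bounded_linear_zero)
  fix \<epsilon> :: real assume "\<epsilon> > 0"
  have "L \<ge> 0" using lip by (rule lipschitz_on_nonneg)
  have "(f has_derivative (\<lambda>x. 0)) (at t)" using f
    by (simp add: has_field_derivative_def lambda_zero)
  then obtain d1 where d1: "d1 > 0" "\<And>s. \<bar>s - t\<bar> < d1 \<Longrightarrow> \<bar>f s - f t\<bar> \<le> \<epsilon> / (L + 1) * \<bar>s - t\<bar>"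
    unfolding has_derivative_within_alt using \<open>\<epsilon> > 0\<close> \<open>L \<ge> 0\<close>
    by (metis UNIV_I add_nonneg_pos diff_zero divide_pos_pos real_norm_def zero_less_one)
  have "isCont f t" using f by (rule DERIV_isCont)
  then obtain d2 where d2: "d2 > 0" "\<And>s. dist s t < d2 \<Longrightarrow> dist (f s) (f t) < e"
    unfolding continuous_at_eps_delta using \<open>e > 0\<close> by blast
  show "\<exists>d>0. \<forall>s\<in>UNIV. norm (s - t) < d \<longrightarrow> norm (h (f s) - h (f t) - (s - t) *\<^sub>R 0) \<le> \<epsilon> * norm (s - t)"
  proof (intro exI[of _ "min d1 d2"] conjI ballI impI)
    fix s :: real assume s: "norm (s - t) < min d1 d2"
    have "f s \<in> ball (f t) e" using d2(2)[of s] s by (simp add: dist_norm norm_minus_commute)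
    then have "norm (h (f s) - h (f t)) \<le> L * \<bar>f s - f t\<bar>"
      using lipschitz_onD[OF lip, of "f s" "f t"] \<open>e > 0\<close> by (simp add: dist_norm)
    also have "\<dots> \<le> (L + 1) * (\<epsilon> / (L + 1) * \<bar>s - t\<bar>)"
      using d1(2)[of s] s \<open>L \<ge> 0\<close> by (intro mult_mono) auto
    also have "\<dots> = \<epsilon> * norm (s - t)" using \<open>L \<ge> 0\<close> by simp
    finally show "norm (h (f s) - h (f t) - (s - t) *\<^sub>R 0) \<le> \<epsilon> * norm (s - t)" by simp
  qed (use d1 d2 in auto)
qed

lemma columnvector_mult_scaleR_one: "columnvector u *v (c *\<^sub>R (1 :: real^1)) = c *\<^sub>R u"
  by (simp add: columnvector_def matrix_vector_mult_def vec_eq_iff)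

lemma bounded_linear_columnvector: "bounded_linear (columnvector :: real^'p \<Rightarrow> real^1^'p)"
  by (rule linear_conv_bounded_linear[THEN iffD1]) (simp add: linear_iff columnvector_def vec_eq_iff)

lemma vec1_eq_scaleR: "x = (x $ 1) *\<^sub>R (1 :: real^1)"
  by (simp add: vec_eq_iff)

section \<open>Conservativity of the Jacobian\<close>

context lasso_path
begin

lemma multipliers_nearby:
  "\<exists>e>0. \<forall>l'\<in>ball l e. \<forall>q\<in>lasso_multipliers X y l' (bhat l'). \<forall>i. i \<notin> eqc l \<longrightarrow> q $ i = 0"
  using eqc_subset_nearby[of l] unfolding lasso_multipliers_def by blast

text \<open>The constant is uniform in \<open>q\<close>: the multipliers fill a compact box, and on
  its product with the unit sphere the norm attains a positive minimum by injectivity.\<close>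

lemma system_matrix_bounded_below:
  "\<exists>c>0. \<forall>q w. (\<forall>i. 0 \<le> q $ i \<and> q $ i \<le> 1) \<longrightarrow> (\<forall>i. i \<notin> eqc l \<longrightarrow> q $ i = 0) \<longrightarrow>
    c * norm w \<le> norm (lasso_system_matrix X q *v w)"
proof -
  define Q :: "(real^'p) set" where "Q = cbox 0 (\<chi> i. if i \<in> eqc l then 1 else 0)"
  have Q: "q \<in> Q \<longleftrightarrow> (\<forall>i. 0 \<le> q $ i \<and> q $ i \<le> 1) \<and> (\<forall>i. i \<notin> eqc l \<longrightarrow> q $ i = 0)" for q
  proof -
    have "q \<in> Q \<longleftrightarrow> (\<forall>i. 0 \<le> q $ i \<and> q $ i \<le> (if i \<in> eqc l then 1 else 0))"
      by (simp add: Q_def mem_box_cart)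
    moreover have "0 \<le> q $ i \<and> q $ i \<le> (if i \<in> eqc l then 1 else 0) \<longleftrightarrow>
        (0 \<le> q $ i \<and> q $ i \<le> 1) \<and> (i \<notin> eqc l \<longrightarrow> q $ i = 0)" for i by auto
    ultimately show ?thesis by blast
  qed
  let ?S = "sphere (0::real^'p) 1"
  let ?f = "\<lambda>z. norm (lasso_system_matrix X (fst z) *v snd z)"
  have eq: "?f = (\<lambda>z. norm (\<chi> i. snd z $ i - fst z $ i * (snd z $ i - (transpose X *v (X *v snd z)) $ i)))"
    by (intro ext arg_cong[of _ _ norm]) (simp add: vec_eq_iff lasso_system_matrix_mult_component)
  have "continuous_on (Q \<times> ?S) ?f"
    unfolding eq by (intro continuous_on_norm continuous_on_vec_lambda continuous_intros
        bounded_linear.continuous_on[OF matrix_vector_mul_bounded_linear])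
  moreover have "compact (Q \<times> ?S)" by (intro compact_Times) (auto simp: Q_def)
  moreover have "Q \<times> ?S \<noteq> {}"
  proof -
    have "0 \<in> Q" by (simp add: Q)
    moreover have "axis undefined 1 \<in> ?S" by simp
    ultimately show ?thesis by blast
  qed
  ultimately obtain z where z: "z \<in> Q \<times> ?S" "\<And>z'. z' \<in> Q \<times> ?S \<Longrightarrow> ?f z \<le> ?f z'"
    using continuous_attains_inf[of "Q \<times> ?S" ?f] by blast
  have "?f z \<noteq> 0"
    using system_matrix_injective[of "fst z" l "snd z"] z(1) by (auto simp: Q)
  then have pos: "?f z > 0" by simp
  have "?f z * norm w \<le> norm (lasso_system_matrix X q *v w)" if "q \<in> Q" for q w
  proof (cases "w = 0")
    case False
    have "?f z \<le> ?f (q, w /\<^sub>R norm w)" using that False by (intro z(2)) auto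
    then show ?thesis
      using False by (simp add: matrix_vector_mult_scaleR field_simps)
  qed simp
  then show ?thesis using pos Q by blast
qed

lemma rhs_norm_le:
  assumes "\<And>i. 0 \<le> q $ i \<and> q $ i \<le> 1"
  shows "norm (rhs l q) \<le> real CARD('p)"
proof -
  have "\<bar>rhs l q $ i\<bar> \<le> 1" for i
    using assms[of i] by (simp add: rhs_component abs_mult sgn_if)
  then have "l1_norm (rhs l q) \<le> (\<Sum>i\<in>(UNIV :: 'p set). 1)" by (intro sum_mono) auto
  then show ?thesis using norm_le_l1_cart[of "rhs l q"] by simp
qed

text \<open>Multipliers at nearby parameters vanish off \<open>eqc l\<close>, so the constant
  \<open>c\<close> found at \<open>l\<close> bounds all the nearby solutions
  \<open>w\<close>.\<close>

lemma jacobian_bounded_nearby: "\<exists>e>0. bounded (\<Union>l'\<in>ball l e. lasso_jacobian X y l' (bhat l'))"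
proof -
  obtain e where e: "e > 0" "\<And>l' q i. l' \<in> ball l e \<Longrightarrow> q \<in> lasso_multipliers X y l' (bhat l') \<Longrightarrow>
      i \<notin> eqc l \<Longrightarrow> q $ i = 0"
    using multipliers_nearby[of l] by blast
  obtain c where c: "c > 0" "\<And>q w. (\<forall>i. 0 \<le> q $ i \<and> q $ i \<le> 1) \<Longrightarrow> (\<forall>i. i \<notin> eqc l \<longrightarrow> q $ i = 0) \<Longrightarrow>
    c * norm w \<le> norm (lasso_system_matrix X q *v w)"
    using system_matrix_bounded_below[of l] by blast
  let ?R = "exp (l + e) * (real CARD('p) / c)"
  have "lasso_jacobian X y l' (bhat l') \<subseteq> columnvector ` cball 0 ?R" if l': "l' \<in> ball l e" for l'
  proof
    fix M assume "M \<in> lasso_jacobian X y l' (bhat l')"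
    then obtain q w where q: "q \<in> lasso_multipliers X y l' (bhat l')"
      "lasso_system_matrix X q *v w = rhs l' q" "M = columnvector (- exp l' *\<^sub>R w)"
      unfolding mem_jacobian_iff by blast
    note q01 = multiplier_bounds[OF q(1)]
    have "c * norm w \<le> real CARD('p)"
      using c(2)[of q w] q01 e(2)[OF l' q(1)] rhs_norm_le[OF q01, of l'] q(2) by simp
    then have "norm w \<le> real CARD('p) / c" using c(1) by (simp add: field_simps)
    moreover have "exp l' \<le> exp (l + e)" using l' by (auto simp: dist_real_def)
    ultimately have "exp l' * norm w \<le> ?R" by (intro mult_mono) auto
    then have "norm (- exp l' *\<^sub>R w) \<le> ?R" by simp
    then show "M \<in> columnvector ` cball 0 ?R" using q(3) by auto
  qed
  then have "(\<Union>l'\<in>ball l e. lasso_jacobian X y l' (bhat l')) \<subseteq> columnvector ` cball 0 ?R" by blast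
  moreover have "bounded ((columnvector ` cball (0::real^'p) ?R) :: (real^1^'p) set)"
    by (intro bounded_linear_image bounded_linear_columnvector bounded_cball)
  ultimately show ?thesis using e(1) bounded_subset by blast
qed

text \<open>Both inactivity of a bound and membership in the support persist nearby, so the
  constraints on \<open>q\<close> survive the limit. The sign can jump only where its argument
  vanishes at \<open>l\<close>; such an index lies off \<open>eqc l\<close>, where the factor
  \<open>qs k $ i\<close> is eventually 0.\<close>

lemma multiplier_system_closed:
  assumes lim: "ls \<longlonglongrightarrow> l" "qs \<longlonglongrightarrow> q" "ws \<longlonglongrightarrow> w"
    and qs: "\<And>k::nat. qs k \<in> lasso_multipliers X y (ls k) (bhat (ls k))"
    and eq: "\<And>k. lasso_system_matrix X (qs k) *v ws k = rhs (ls k) (qs k)"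
  shows "q \<in> lasso_multipliers X y l (bhat l)" "lasso_system_matrix X q *v w = rhs l q"
proof -
  have qi: "(\<lambda>k. qs k $ i) \<longlonglongrightarrow> q $ i" for i using lim(2) by (rule tendsto_vec_nth)
  have q_off: "eventually (\<lambda>k. qs k $ i = 0) sequentially" if "i \<notin> eqc l" for i
  proof -
    have "eventually (\<lambda>k. i \<notin> eqc (ls k)) sequentially"
      using eventually_not_eqc[OF that] lim(1) by (rule eventually_compose_filterlim)
    then show ?thesis by (rule eventually_mono) (use qs in \<open>auto simp: lasso_multipliers_def\<close>)
  qed
  have q0: "q $ i = 0" if "i \<notin> eqc l" for i
    by (rule LIMSEQ_unique[OF qi tendsto_eventually[OF q_off[OF that]]])
  have q1: "q $ i = 1" if "i \<in> supp_vec (bhat l)" for i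
  proof -
    have "(\<lambda>k. bhat (ls k) $ i) \<longlonglongrightarrow> bhat l $ i"
      by (intro tendsto_vec_nth isCont_tendsto_compose[OF bhat_isCont lim(1)])
    then have "eventually (\<lambda>k. bhat (ls k) $ i \<noteq> 0) sequentially"
      using that by (intro tendsto_imp_eventually_ne) (auto simp: supp_vec_def)
    then have "eventually (\<lambda>k. qs k $ i = 1) sequentially"
      by (rule eventually_mono) (use qs in \<open>auto simp: lasso_multipliers_def supp_vec_def\<close>)
    then show ?thesis by (rule LIMSEQ_unique[OF qi tendsto_eventually])
  qed
  have "0 \<le> q $ i \<and> q $ i \<le> 1" for i
    using multiplier_bounds[OF qs] by (auto intro!: LIMSEQ_le_const[OF qi] LIMSEQ_le_const2[OF qi])
  then show "q \<in> lasso_multipliers X y l (bhat l)"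
    using q0 q1 by (auto simp: lasso_multipliers_def)
  show "lasso_system_matrix X q *v w = rhs l q"
    unfolding vec_eq_iff
  proof
    fix i
    have "(\<lambda>k. ws k $ i - qs k $ i * (ws k $ i - (transpose X *v (X *v ws k)) $ i))
        \<longlonglongrightarrow> w $ i - q $ i * (w $ i - (transpose X *v (X *v w)) $ i)"
      by (intro tendsto_intros qi tendsto_vec_nth lim(3)
          bounded_linear.tendsto[OF matrix_vector_mul_bounded_linear])
    then have 1: "(\<lambda>k. rhs (ls k) (qs k) $ i) \<longlonglongrightarrow> (lasso_system_matrix X q *v w) $ i"
      unfolding lasso_system_matrix_mult_component[symmetric] eq .
    have 2: "(\<lambda>k. rhs (ls k) (qs k) $ i) \<longlonglongrightarrow> rhs l q $ i"
    proof (cases "i \<in> eqc l")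
      case True
      have "isCont (\<lambda>l. bhat l $ i + corr l $ i) l"
        using bhat_isCont[of l] unfolding isCont_def
        by (intro tendsto_add tendsto_vec_nth corr_tendsto)
      then have "(\<lambda>k. bhat (ls k) $ i + corr (ls k) $ i) \<longlonglongrightarrow> bhat l $ i + corr l $ i"
        by (rule isCont_tendsto_compose[OF _ lim(1)])
      then show ?thesis
        unfolding rhs_component using sgn_on_eqc(2)[OF True] by (intro tendsto_mult qi tendsto_sgn)
    next
      case False
      have "eventually (\<lambda>k. rhs (ls k) (qs k) $ i = 0) sequentially"
        using q_off[OF False] by (rule eventually_mono) (simp add: rhs_component)
      then show ?thesis using q0[OF False] by (simp add: rhs_component tendsto_eventually)
    qed
    show "(lasso_system_matrix X q *v w) $ i = rhs l q $ i"
      using 1 2 by (rule LIMSEQ_unique)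
  qed
qed

lemma jacobian_closed_graph:
  "closed {(x :: real^1, M). M \<in> lasso_jacobian X y (x $ 1) (bhat (x $ 1))}"
  unfolding closed_sequential_limits
proof (intro allI impI, elim conjE)
  fix S :: "nat \<Rightarrow> (real^1) \<times> (real^1^'p)" and z
  assume S: "\<forall>k. S k \<in> {(x, M). M \<in> lasso_jacobian X y (x $ 1) (bhat (x $ 1))}" and lim: "S \<longlonglongrightarrow> z"
  define ls where "ls k = fst (S k) $ 1" for k
  define l where "l = fst z $ 1"
  have "\<forall>k. \<exists>q w. q \<in> lasso_multipliers X y (ls k) (bhat (ls k)) \<and>
      lasso_system_matrix X q *v w = rhs (ls k) q \<and> snd (S k) = columnvector (- exp (ls k) *\<^sub>R w)"
  proof
    fix k
    have "snd (S k) \<in> lasso_jacobian X y (ls k) (bhat (ls k))"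
      using S[rule_format, of k] by (simp add: ls_def case_prod_beta)
    then show "\<exists>q w. q \<in> lasso_multipliers X y (ls k) (bhat (ls k)) \<and>
      lasso_system_matrix X q *v w = rhs (ls k) q \<and> snd (S k) = columnvector (- exp (ls k) *\<^sub>R w)"
      unfolding mem_jacobian_iff .
  qed
  then obtain qs ws where q: "\<And>k. qs k \<in> lasso_multipliers X y (ls k) (bhat (ls k))"
    "\<And>k. lasso_system_matrix X (qs k) *v ws k = rhs (ls k) (qs k)"
    "\<And>k. snd (S k) = columnvector (- exp (ls k) *\<^sub>R ws k)"
    by metis
  have ls: "ls \<longlonglongrightarrow> l"
    unfolding ls_def[abs_def] l_def by (intro tendsto_intros tendsto_vec_nth lim)
  \<comment> \<open>The matrix determines \<open>w\<close>, so \<open>ws\<close> converges along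
    with the sequence; only the multipliers call for a subsequence.\<close>
  have wsi: "ws k $ i = - exp (- ls k) * (snd (S k) $ i $ 1)" for k i
    unfolding q(3) by (simp add: columnvector_def exp_minus)
  define w :: "real^'p" where "w = (\<chi> i. - exp (- l) * (snd z $ i $ 1))"
  have "(\<lambda>k. ws k $ i) \<longlonglongrightarrow> w $ i" for i
    unfolding wsi w_def vec_lambda_beta by (intro tendsto_intros tendsto_vec_nth lim ls)
  then have ws: "ws \<longlonglongrightarrow> w" by (rule vec_tendstoI)
  have "\<forall>k. qs k \<in> cbox 0 1" using multiplier_bounds[OF q(1)] by (simp add: mem_box_cart)
  then obtain q0 r where r: "strict_mono r" "(qs \<circ> r) \<longlonglongrightarrow> q0"
    using compact_cbox[of 0 "1 :: real^'p"] unfolding compact_eq_seq_compact_metric seq_compact_def by metis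
  have "(ls \<circ> r) \<longlonglongrightarrow> l" "(ws \<circ> r) \<longlonglongrightarrow> w"
    using LIMSEQ_subseq_LIMSEQ[OF ls r(1)] LIMSEQ_subseq_LIMSEQ[OF ws r(1)] .
  from multiplier_system_closed[OF this(1) r(2) this(2)] q(1,2)
  have "q0 \<in> lasso_multipliers X y l (bhat l)" "lasso_system_matrix X q0 *v w = rhs l q0"
    by simp_all
  moreover have "snd z = columnvector (- exp l *\<^sub>R w)"
    by (simp add: w_def columnvector_def vec_eq_iff exp_minus forall_1)
  ultimately have "snd z \<in> lasso_jacobian X y l (bhat l)" unfolding mem_jacobian_iff by blast
  then show "z \<in> {(x, M). M \<in> lasso_jacobian X y (x $ 1) (bhat (x $ 1))}"
    by (simp add: l_def case_prod_beta)
qed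

lemma jacobian_nonempty: "lasso_jacobian X y l (bhat l) \<noteq> {}"
proof -
  have "(\<chi> i. if i \<in> supp_vec (bhat l) then 1 else 0) \<in> lasso_multipliers X y l (bhat l)"
    using lasso_kkt_supp_subset[OF kkt, of _ l] by (auto simp: lasso_multipliers_def supp_vec_def)
  then show ?thesis unfolding lasso_jacobian_def by blast
qed

lemma chain_rule_AE:
  assumes "absolutely_continuous_fun_on {0..1} (g :: real \<Rightarrow> real^1)"
  shows "AE t in lebesgue_on {0..1}. \<exists>v. (g has_vector_derivative v) (at t within {0..1}) \<and>
    (\<forall>M\<in>lasso_jacobian X y (g t $ 1) (bhat (g t $ 1)).
      ((\<lambda>s. bhat (g s $ 1)) has_vector_derivative (M *v v)) (at t within {0..1}))"
proof -
  define f where "f t = g t $ 1" for t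
  have g: "g = (\<lambda>t. f t *\<^sub>R 1)" unfolding f_def using vec1_eq_scaleR by auto
  have "norm (g u - g v) = \<bar>f u - f v\<bar>" for u v by (simp add: f_def norm_real)
  then have "absolutely_continuous_fun_on {0..1} f"
    using assms unfolding absolutely_continuous_fun_on_def by simp
  then have D: "AE t in lebesgue_on {0..1}. \<exists>v. (f has_real_derivative v) (at t)"
    by (rule absolutely_continuous_AE_differentiable)
  \<comment> \<open>Times at which the curve crosses a breakpoint with nonzero speed.\<close>
  let ?Z = "\<Union>c\<in>breakpoints. {t. f t = c \<and> (\<exists>v. v \<noteq> 0 \<and> (f has_real_derivative v) (at t))}"
  have "countable ?Z"
    using finite_breakpoints countable_level_nonzero_derivative
    by (intro countable_UN) (auto intro: countable_finite)
  then have "negligible ?Z"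
    unfolding negligible_iff_null_sets
    by (intro null_sets_completionI countable_imp_null_set_lborel)
  then have "?Z \<inter> {0..1} \<in> null_sets (lebesgue_on {0..1})"
    using negligible_subset[of ?Z "?Z \<inter> {0..1}"]
    by (subst null_sets_restrict_space) (auto simp: negligible_iff_null_sets)
  then have "AE t in lebesgue_on {0..1}. t \<notin> ?Z"
    by (rule AE_I') (auto simp: space_restrict_space)
  with D show ?thesis
  proof eventually_elim
    case (elim t)
    then obtain v where v: "(f has_real_derivative v) (at t)" by blast
    have "(g has_vector_derivative v *\<^sub>R 1) (at t)"
      unfolding g using v by (auto intro!: derivative_eq_intros)
    moreover have "((\<lambda>s. bhat (f s)) has_vector_derivative (M *v (v *\<^sub>R 1))) (at t)"
      if M: "M \<in> lasso_jacobian X y (f t) (bhat (f t))" for M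
    proof (cases "v = 0")
      case True
      obtain e L where "e > 0" "L-lipschitz_on (ball (f t) e) bhat" using lipschitz_nearby by blast
      then show ?thesis
        using lipschitz_compose_zero_derivative[of L f t e bhat] v True by simp
    next
      case False
      then have "f t \<notin> breakpoints" using elim(2) v by blast
      then obtain d where d: "(bhat has_vector_derivative - exp (f t) *\<^sub>R d) (at (f t))"
        "\<And>q. q \<in> lasso_multipliers X y (f t) (bhat (f t)) \<Longrightarrow> lasso_system_matrix X q *v d = rhs (f t) q"
        using derivative_off_breakpoints by blast
      obtain q w where q: "q \<in> lasso_multipliers X y (f t) (bhat (f t))"
        "lasso_system_matrix X q *v w = rhs (f t) q" "M = columnvector (- exp (f t) *\<^sub>R w)"
        using M unfolding mem_jacobian_iff by blast
      \<comment> \<open>The derivative \<open>d\<close> and the solution \<open>w\<close> behind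
        \<open>M\<close> solve the same injective system, so \<open>M\<close> is the derivative
        whichever \<open>q\<close> produced it.\<close>
      have "lasso_system_matrix X q *v (w - d) = 0"
        using q(2) d(2)[OF q(1)] by (simp add: matrix_vector_mult_diff_distrib)
      moreover have "q $ i = 0" if "i \<notin> eqc (f t)" for i
        using q(1) that by (simp add: lasso_multipliers_def)
      ultimately have "w - d = 0"
        using system_matrix_injective[OF multiplier_bounds[OF q(1)]] by blast
      then have "M *v (v *\<^sub>R 1) = v *\<^sub>R (- exp (f t) *\<^sub>R d)"
        using q(3) columnvector_mult_scaleR_one[of "- exp (f t) *\<^sub>R d" v] by simp
      then show ?thesis
        using vector_diff_chain_at[of f v t bhat, OF _ d(1)] v
        by (simp add: o_def has_real_derivative_iff_has_vector_derivative)
    qed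
    ultimately show ?case
      unfolding f_def by (blast intro: has_vector_derivative_at_within)
  qed
qed

lemma dist_component_le: "dist (x $ 1) (z $ 1) \<le> dist x z" for x z :: "real^1"
  by (simp add: dist_vec_def L2_set_def)

lemma conservative_jacobian_bhat:
  "conservative_jacobian (\<lambda>l::real^1. bhat (l $ 1)) (\<lambda>l. lasso_jacobian X y (l $ 1) (bhat (l $ 1)))"
  unfolding conservative_jacobian_def
proof (intro conjI allI impI)
  fix x :: "real^1"
  obtain e where e: "e > 0" "bounded (\<Union>l'\<in>ball (x $ 1) e. lasso_jacobian X y l' (bhat l'))"
    using jacobian_bounded_nearby by blast
  have "z $ 1 \<in> ball (x $ 1) e" if "z \<in> ball x e" for z
    using that dist_component_le[of x z] by simp
  then have "(\<Union>z\<in>ball x e. lasso_jacobian X y (z $ 1) (bhat (z $ 1)))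
      \<subseteq> (\<Union>l'\<in>ball (x $ 1) e. lasso_jacobian X y l' (bhat l'))" by blast
  then show "\<exists>e>0. bounded (\<Union>z\<in>ball x e. lasso_jacobian X y (z $ 1) (bhat (z $ 1)))"
    using e bounded_subset by blast
qed (use jacobian_nonempty jacobian_closed_graph chain_rule_AE in auto)

lemma locally_lipschitz_bhat: "locally_lipschitz (\<lambda>l::real^1. bhat (l $ 1))"
  unfolding locally_lipschitz_def
proof
  fix x :: "real^1"
  obtain e L where e: "e > 0" "L-lipschitz_on (ball (x $ 1) e) bhat" using lipschitz_nearby by blast
  have "L-lipschitz_on (ball x e) (\<lambda>l. bhat (l $ 1))"
  proof (rule lipschitz_onI)
    show "0 \<le> L" using e(2) by (rule lipschitz_on_nonneg)
    fix u v assume uv: "u \<in> ball x e" "v \<in> ball x e"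
    have "u $ 1 \<in> ball (x $ 1) e" "v $ 1 \<in> ball (x $ 1) e"
      using uv dist_component_le[of x u] dist_component_le[of x v] by auto
    then have "dist (bhat (u $ 1)) (bhat (v $ 1)) \<le> L * dist (u $ 1) (v $ 1)"
      by (rule lipschitz_onD[OF e(2)])
    also have "\<dots> \<le> L * dist u v"
      using \<open>0 \<le> L\<close> by (intro mult_left_mono dist_component_le)
    finally show "dist (bhat (u $ 1)) (bhat (v $ 1)) \<le> L * dist u v" .
  qed
  then show "\<exists>e>0. \<exists>L. L-lipschitz_on (ball x e) (\<lambda>l. bhat (l $ 1))" using e(1) by blast
qed

end

text \<open>Parameters are wrapped in \<open>real^1\<close> so that Jacobians are one-column
  matrices. The invertibility conjunct certifies that \<open>matrix_inv\<close> in
  \<open>lasso_jacobian\<close> denotes a true inverse and not an arbitrary choice.\<close>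

theorem proposition5:
  fixes X :: "real^'p^'n" and y :: "real^'n"
  assumes "\<And>l b. b \<in> lasso_argmin X y l \<Longrightarrow>
             invertible_principal_submatrix (transpose X ** X) (equicorrelation_set X y l b)"
  shows "\<exists>bhat :: real \<Rightarrow> real^'p.
           (\<forall>l. lasso_argmin X y l = {bhat l}) \<and>
           (\<forall>l. \<forall>q\<in>lasso_multipliers X y l (bhat l). invertible (lasso_system_matrix X q)) \<and>
           path_differentiable (\<lambda>l::real^1. bhat (l $ 1)) \<and>
           conservative_jacobian (\<lambda>l::real^1. bhat (l $ 1))
             (\<lambda>l. lasso_jacobian X y (l $ 1) (bhat (l $ 1)))"
proof -
  define bhat where "bhat l = (SOME b. b \<in> lasso_argmin X y l)" for l
  have mem: "bhat l \<in> lasso_argmin X y l" for l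
    unfolding bhat_def by (rule someI_ex) (use lasso_argmin_nonempty in blast)
  interpret lasso_path X y bhat
  proof
    show "lasso_kkt X y (exp l) (bhat l)" for l
      using mem by (simp add: lasso_argmin_iff_kkt)
    show "w = 0" if "\<And>i. i \<notin> equicorrelation_set X y l (bhat l) \<Longrightarrow> w $ i = 0" "X *v w = 0" for l w
      using invertible_principal_submatrix_injective[OF assms[OF mem] that] .
  qed
  have "lasso_argmin X y l = {bhat l}" for l
    using mem unique by (auto simp: lasso_argmin_iff_kkt)
  then show ?thesis
    using system_matrix_invertible conservative_jacobian_bhat locally_lipschitz_bhat
    unfolding path_differentiable_def by blast
qed

end
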